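(* Let $n\ge4$, let $G$ be the pan graph on $n$ vertices, and let $\mathbf{X}_G=\sum_{\lambda\vdash n}c_\lambda\,\mathfrak{st}_\lambda$ be its star-expansion. Then for $\lambda=(1^{m_1}2^{m_2}\cdots n^{m_n})\vdash n$ we have: \begin{itemize} \item if $\lambda=(n-m_1,1^{m_1})$ is a hook with $0\le m_1\le n-2$, then \[c_\lambda=(-1)^{m_1}(n-2)\binom{n-3}{m_1};\] \item if $\lambda$ is not a hook partition, then \[c_\lambda=(-1)^{m_1}\frac{n-\ell(\lambda)}{\ell(\lambda)-m_1}\binom{m_2+\cdots+m_n}{m_2,\dots,m_n}\binom{n-\ell(\lambda)+m_1-1}{m_1};\] \item $c_{(1^n)}=0$. \end{itemize}
   Context: The chromatic symmetric function of a finite simple graph $G$ with vertices $v_1,\dots,v_n$ is $\mathbf{X}_G=\sum_\kappa x_{\kappa(v_1)}\cdots x_{\kappa(v_n)}$, summed over all proper colorings $\kappa:V(G)\to\mathbb{N}$. The star graph $\mathsf{St}_k$ on $k$ vertices is the tree with one central vertex adjacent to $k-1$ leaves ($\mathsf{St}_1$ is a single vertex); $\mathfrak{st}_k:=\mathbf{X}_{\mathsf{St}_k}$, and $\mathfrak{st}_\lambda:=\mathfrak{st}_{\lambda_1}\mathfrak{st}_{\lambda_2}\cdots$ for a partition $\lambda$. The set $\{\mathfrak{st}_\lambda:\lambda\vdash n\}$ is a $\mathbb{Q}$-basis (the star-basis) of the space of homogeneous symmetric functions of degree $n$, so the coefficients $c_\lambda$ are uniquely determined. The pan graph on $n$ vertices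 is the graph consisting of a cycle on $n-1$ vertices together with one leaf attached to one vertex of the cycle. The notation $\lambda=(1^{m_1}2^{m_2}\cdots n^{m_n})$ means $\lambda$ has exactly $m_i$ parts equal to $i$; $\ell(\lambda)$ is the number of parts. A hook partition of $n$ is one of the form $(a,1^{n-a})$ with $1\le a\le n$ (so $(1^n)$ counts as a hook). $\binom{m_2+\cdots+m_n}{m_2,\dots,m_n}=\frac{(m_2+\cdots+m_n)!}{m_2!\cdots m_n!}$, and $\binom ab=0$ for $b>a\ge0$. *)

theory Defs
  imports Complex_Main "HOL-Library.Multiset" "HOL-Library.FuncSet"
begin

text \<open>
  Formal power series in countably many commuting variables \<open>x\<^sub>0, x\<^sub>1, \<dots>\<close> with coefficients in
  \<open>'a\<close>. The monomial \<open>x\<^bsub>i\<^sub>1\<^esub> \<cdots> x\<^bsub>i\<^sub>k\<^esub>\<close> is encoded as the multiset \<open>{#i\<^sub>1, \<dots>, i\<^sub>k#}\<close> of its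
  variable indices, so that multiplying monomials is adding multisets.
\<close>

typedef 'a mfps = "UNIV :: (nat multiset \<Rightarrow> 'a) set"
  morphisms mfps_coeff Abs_mfps ..

setup_lifting type_definition_mfps

lemma mfps_eqI: "(\<And>m. mfps_coeff f m = mfps_coeff g m) \<Longrightarrow> f = g"
  by (metis mfps_coeff_inject ext)

lemma mfps_coeff_Abs [simp]: "mfps_coeff (Abs_mfps f) = f"
  by (simp add: Abs_mfps_inverse)

lemma finite_msubsets: "finite {a. a \<subseteq># (m :: 'b multiset)}"
proof (induction m)
  case (add x m)
  have "{a. a \<subseteq># add_mset x m} \<subseteq> {a. a \<subseteq># m} \<union> add_mset x ` {a. a \<subseteq># m}"
  proof
    fix a assume a: "a \<in> {a. a \<subseteq># add_mset x m}"
    show "a \<in> {a. a \<subseteq># m} \<union> add_mset x ` {a. a \<subseteq># m}"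
    proof (cases "x \<in># a")
      case True
      then obtain b where "a = add_mset x b" by (metis mset_add)
      then show ?thesis using a by auto
    next
      case False
      then have "a \<subseteq># m"
        using a subset_eq_diff_conv [of a "{#x#}" m] by (simp add: diff_single_trivial)
      then show ?thesis by simp
    qed
  qed
  then show ?case using add by (meson finite_Un finite_imageI finite_subset)
qed simp

lemma finite_mset_decomps: "finite {(a, b). a + b = (m :: 'b multiset)}"
proof (rule finite_subset)
  show "{(a, b). a + b = m} \<subseteq> {a. a \<subseteq># m} \<times> {a. a \<subseteq># m}" by auto
qed (simp add: finite_msubsets)

instantiation mfps :: (comm_ring_1) comm_ring_1
begin

lift_definition zero_mfps :: "'a mfps" is "\<lambda>_. 0" .
lift_definition one_mfps :: "'a mfps" is "\<lambda>m. if m = {#} then 1 else 0" .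
lift_definition plus_mfps :: "'a mfps \<Rightarrow> 'a mfps \<Rightarrow> 'a mfps" is "\<lambda>f g m. f m + g m" .
lift_definition minus_mfps :: "'a mfps \<Rightarrow> 'a mfps \<Rightarrow> 'a mfps" is "\<lambda>f g m. f m - g m" .
lift_definition uminus_mfps :: "'a mfps \<Rightarrow> 'a mfps" is "\<lambda>f m. - f m" .
lift_definition times_mfps :: "'a mfps \<Rightarrow> 'a mfps \<Rightarrow> 'a mfps" is
  "\<lambda>f g m. \<Sum>(a, b) \<in> {(a, b). a + b = m}. f a * g b" .

instance
proof
  fix f g h :: "'a mfps"
  show "f * g * h = f * (g * h)"
  proof (transfer, rule ext)
    fix f g h :: "nat multiset \<Rightarrow> 'a" and m :: "nat multiset"
    have "(\<Sum>(a, b) \<in> {(a, b). a + b = m}. (\<Sum>(a, b) \<in> {(p, q). p + q = a}. f a * g b) * h b) =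
        (\<Sum>(x, y) \<in> Sigma {(a, b). a + b = m} (\<lambda>(a, b). {(p, q). p + q = a}).
           f (fst y) * g (snd y) * h (snd x))"
      by (subst sum.Sigma [symmetric])
         (simp_all add: finite_mset_decomps sum_distrib_right case_prod_unfold
            finite_mset_decomps [unfolded case_prod_unfold])
    also have "\<dots> =
        (\<Sum>(x, y) \<in> Sigma {(a, b). a + b = m} (\<lambda>(a, b). {(p, q). p + q = b}).
           f (fst x) * (g (fst y) * h (snd y)))"
      by (rule sum.reindex_bij_witness
            [where i = "\<lambda>((a, b), (p, q)). ((a + p, q), (a, p))"
               and j = "\<lambda>((a, b), (p, q)). ((p, q + b), (q, b))"])
         (clarsimp simp: add.assoc mult.assoc)+
    also have "\<dots> =
        (\<Sum>(a, b) \<in> {(a, b). a + b = m}. f a * (\<Sum>(a, b) \<in> {(p, q). p + q = b}. g a * h b))"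
      by (subst sum.Sigma [symmetric])
         (simp_all add: finite_mset_decomps sum_distrib_left case_prod_unfold
            finite_mset_decomps [unfolded case_prod_unfold])
    finally show "(\<Sum>(a, b) \<in> {(a, b). a + b = m}. (\<Sum>(a, b) \<in> {(p, q). p + q = a}. f a * g b) * h b) =
        (\<Sum>(a, b) \<in> {(a, b). a + b = m}. f a * (\<Sum>(a, b) \<in> {(p, q). p + q = b}. g a * h b))" .
  qed
  show "f * g = g * f"
  proof (transfer, rule ext)
    fix f g :: "nat multiset \<Rightarrow> 'a" and m :: "nat multiset"
    show "(\<Sum>(a, b) \<in> {(a, b). a + b = m}. f a * g b) = (\<Sum>(a, b) \<in> {(a, b). a + b = m}. g a * f b)"
      by (rule sum.reindex_bij_witness [where i = prod.swap and j = prod.swap])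
         (auto simp: ac_simps)
  qed
  show "1 * f = f"
  proof (transfer, rule ext)
    fix f :: "nat multiset \<Rightarrow> 'a" and m :: "nat multiset"
    have "(\<Sum>(a, b) \<in> {(a, b). a + b = m}. (if a = {#} then 1 else 0) * f b) =
        (\<Sum>(a, b) \<in> {({#} :: nat multiset, m)}. (if a = {#} then 1 else 0) * f b)"
      by (rule sum.mono_neutral_right) (auto simp: finite_mset_decomps split: if_splits)
    then show "(\<Sum>(a, b) \<in> {(a, b). a + b = m}. (if a = {#} then 1 else 0) * f b) = f m"
      by simp
  qed
  show "(f + g) * h = f * h + g * h"
    by (transfer, rule ext) (simp add: algebra_simps split_def sum.distrib)
  show "(0 :: 'a mfps) \<noteq> 1"
    by (transfer) (metis zero_neq_one)
qed (transfer; simp add: algebra_simps fun_eq_iff)+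

end

lift_definition mfps_scale :: "'a :: comm_ring_1 \<Rightarrow> 'a mfps \<Rightarrow> 'a mfps" is "\<lambda>c f m. c * f m" .

text \<open>A graph is a pair of a vertex set and a set of edges, each edge being a two-element set.\<close>

type_synonym 'v ugraph = "'v set \<times> 'v set set"

definition fin_simple_graph :: "'v ugraph \<Rightarrow> bool" where
  "fin_simple_graph G \<longleftrightarrow>
     finite (fst G) \<and> (\<forall>e \<in> snd G. e \<subseteq> fst G \<and> card e = 2)"

text \<open>Extensionality outside the vertex set makes each colouring of the vertices count once.\<close>

definition proper_colourings :: "'v ugraph \<Rightarrow> ('v \<Rightarrow> nat) set" where
  "proper_colourings G =
     {\<kappa> \<in> fst G \<rightarrow>\<^sub>E UNIV. \<forall>u v. {u, v} \<in> snd G \<longrightarrow> \<kappa> u \<noteq> \<kappa> v}"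

text \<open>
  The infinite formal sum of the monomials \<open>\<Prod>v. x\<^bsub>\<kappa> v\<^esub>\<close> over all proper colourings \<open>\<kappa>\<close>: the
  coefficient of a monomial is the number of proper colourings producing it.
\<close>

definition chromatic_sf :: "'v ugraph \<Rightarrow> rat mfps" where
  "chromatic_sf G = Abs_mfps (\<lambda>m.
     of_nat (card {\<kappa> \<in> proper_colourings G. image_mset \<kappa> (mset_set (fst G)) = m}))"

lemma finite_colourings_of_monomial:
  assumes "finite (fst G)"
  shows "finite {\<kappa> \<in> proper_colourings G. image_mset \<kappa> (mset_set (fst G)) = m}"
proof (rule finite_subset)
  show "{\<kappa> \<in> proper_colourings G. image_mset \<kappa> (mset_set (fst G)) = m}
      \<subseteq> fst G \<rightarrow>\<^sub>E set_mset m"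
  proof
    fix \<kappa> assume "\<kappa> \<in> {\<kappa> \<in> proper_colourings G. image_mset \<kappa> (mset_set (fst G)) = m}"
    then have \<kappa>: "\<kappa> \<in> fst G \<rightarrow>\<^sub>E UNIV" and m: "image_mset \<kappa> (mset_set (fst G)) = m"
      by (auto simp: proper_colourings_def)
    have "set_mset m = \<kappa> ` fst G"
      using m assms by auto
    with \<kappa> show "\<kappa> \<in> fst G \<rightarrow>\<^sub>E set_mset m"
      by (auto simp: PiE_iff)
  qed
  show "finite (fst G \<rightarrow>\<^sub>E set_mset m)"
    using assms by (simp add: finite_PiE)
qed

definition star_graph :: "nat \<Rightarrow> nat ugraph" where
  "star_graph k = ({0..<k}, {{0, i} | i. 1 \<le> i \<and> i < k})"

text \<open>The cycle runs through \<open>0, \<dots>, n - 2\<close>; the leaf \<open>n - 1\<close> is attached to \<open>0\<close>.\<close>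

definition pan_graph :: "nat \<Rightarrow> nat ugraph" where
  "pan_graph n =
     ({0..<n}, {{i, (i + 1) mod (n - 1)} | i. i < n - 1} \<union> {{0, n - 1}})"

lemma fin_simple_graph_star: "fin_simple_graph (star_graph k)"
  by (auto simp: fin_simple_graph_def star_graph_def)

lemma fin_simple_graph_pan:
  assumes "n \<ge> 4"
  shows "fin_simple_graph (pan_graph n)"
proof -
  have "(i + 1) mod (n - 1) < n \<and> i \<noteq> (i + 1) mod (n - 1)" if "i < n - 1" for i
    using that assms by (cases "i + 1 = n - 1") auto
  then show ?thesis
    using assms by (auto simp: fin_simple_graph_def pan_graph_def)
qed

definition star_sf :: "nat \<Rightarrow> rat mfps" where
  "star_sf k = chromatic_sf (star_graph k)"

text \<open>An integer partition is the multiset of its (positive) parts.\<close>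

definition partitions :: "nat \<Rightarrow> nat multiset set" where
  "partitions n = {\<mu>. 0 \<notin># \<mu> \<and> \<Sum>\<^sub># \<mu> = n}"

lemma finite_partitions: "finite (partitions n)"
proof (rule finite_subset)
  show "partitions n \<subseteq> {\<mu>. \<mu> \<subseteq># (\<Sum>i \<in> {1..n}. replicate_mset n i)}"
  proof safe
    fix \<mu> assume "\<mu> \<in> partitions n"
    then have 0: "0 \<notin># \<mu>" and n: "\<Sum>\<^sub># \<mu> = n"
      by (auto simp: partitions_def)
    have le: "count \<nu> x * x \<le> \<Sum>\<^sub># \<nu>" for \<nu> :: "nat multiset" and x
      by (induction \<nu>) auto
    show "\<mu> \<subseteq># (\<Sum>i \<in> {1..n}. replicate_mset n i)"
    proof (rule mset_subset_eqI)
      fix x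
      show "count \<mu> x \<le> count (\<Sum>i \<in> {1..n}. replicate_mset n i) x"
      proof (cases "x \<in># \<mu>")
        case True
        then have pos: "x \<ge> 1" "count \<mu> x \<ge> 1"
          using 0 by (metis gr0I less_one not_le, simp add: Suc_le_eq)
        have "count \<mu> x * x \<le> n" using le [of \<mu> x] n by simp
        moreover have "count \<mu> x * 1 \<le> count \<mu> x * x" "1 * x \<le> count \<mu> x * x"
          using pos by (meson mult_le_mono le_refl)+
        ultimately have "count \<mu> x \<le> n" "x \<le> n" by linarith+
        then show ?thesis using pos by (simp add: count_sum)
      qed (simp add: not_in_iff)
    qed
  qed
qed (rule finite_msubsets)

definition star_sf_part :: "nat multiset \<Rightarrow> rat mfps" where
  "star_sf_part \<mu> = (\<Prod>k \<in># \<mu>. star_sf k)"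

definition is_hook :: "nat \<Rightarrow> nat multiset \<Rightarrow> bool" where
  "is_hook n \<mu> \<longleftrightarrow> (\<exists>a \<in> {1..n}. \<mu> = add_mset a (replicate_mset (n - a) 1))"

definition multinomial :: "nat set \<Rightarrow> (nat \<Rightarrow> nat) \<Rightarrow> rat" where
  "multinomial I m = fact (\<Sum>i \<in> I. m i) / (\<Prod>i \<in> I. fact (m i))"

end

theory Submission
  imports Defs "HOL-Computational_Algebra.Formal_Power_Series"
    "HOL-Combinatorics.Multiset_Permutations"
begin

text \<open>
  A proper colouring of a path or a cycle is a word without equal neighbouring letters. Allowing
  the first two letters to be equal yields recurrences that involve, besides such words, only words
  whose first letter carries extra copies, and these recurrences are linear over the power sums.
  With \<open>s = st\<^sub>1\<close> and \<open>V = \<Sum>k\<ge>2. st\<^sub>k z\<^sup>k (1 + s z)\<^bsup>1 - k\<^esup>\<close>, their solution gives the generating function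
  \<open>1 - V + (1 + s z) (z V' - 1) / (1 - V)\<close> of the pan graphs. As \<open>z V' V\<^bsup>j - 1\<^esup> = z (V\<^sup>j)' / j\<close>, it
  equals \<open>(\<Sum>j\<ge>1. (1 + s z) (z (V\<^sup>j)' / j - V\<^sup>j)) - V\<close> up to its linear term. The summand for \<open>j\<close>
  contributes the star products with exactly \<open>j\<close> parts greater than one, and the final \<open>- V\<close> only
  concerns the hooks.

  The star coefficients are unique because \<open>st\<^sub>\<mu>\<close> is a nonzero multiple of \<open>p\<^sub>\<mu>\<close> plus power sum
  products with more parts.
\<close>

text \<open>As identities between series in \<open>z\<close>, the recurrences lead from
  \<open>k\<close> to \<open>k + 1\<close> and have no base case. Solutions are therefore verified
  by comparison: the difference of two solutions is divisible by every power of \<open>z\<close>.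
  Let \<open>P k\<close> be the sum of \<open>(- z)^i * p (k + i)\<close> over all \<open>i\<close>.
  Inclusion-exclusion over equal neighbours turns paths into \<open>1 / (1 - z P 0)\<close>, where a
  run of \<open>r + 1\<close> merged letters contributes \<open>p r\<close> up to sign. Around a
  cycle the run through the base point can be placed in as many ways as it has letters, which
  produces the derivative of \<open>z P 0\<close>; merging along all edges of the cycle at once adds
  the correction \<open>- z P 0\<close>. This correction is what survives as the final
  \<open>- V\<close> and makes hooks exceptional. Stars obey the recurrence of \<open>P\<close>
  except for an extra summand \<open>s z\<close> times the star series itself. The substitution
  \<open>u = z / (1 + s z)\<close> absorbs it, because \<open>1 - s u = u / z\<close>, and gives
  \<open>1 - z P 0 = (1 - V) / (1 + s z)\<close>. This is the origin of \<open>V\<close> and of its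
  powers of \<open>1 + s z\<close>.\<close>

unbundle fps_syntax

section \<open>Composition of formal power series over a commutative ring\<close>

text \<open>Iterating the hypothesis makes each \<open>a i\<close> divisible by all powers of
  \<open>v\<close>, so no lowest nonzero coefficient can exist. This serves families that recur only
  towards larger indices, and also families indexed by series, with \<open>fps_shift 1\<close> as
  \<open>\<sigma>\<close>.\<close>

lemma fps_eq_0_if_contracting:
  fixes a :: "'i \<Rightarrow> 'a::comm_ring_1 fps"
  assumes "\<And>i. a i = v * a (\<sigma> i)" and "v $ 0 = 0"
  shows "a i = 0"
proof -
  have "a i $ n = 0" for n i
  proof (induction n arbitrary: i rule: less_induct)
    case (less n)
    have "v $ k * a (\<sigma> i) $ (n - k) = 0" if "k \<le> n" for k
      using that less assms(2) by (cases "k = 0") auto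
    then have "(v * a (\<sigma> i)) $ n = 0"
      by (simp add: fps_mult_nth)
    then show ?case by (metis assms(1))
  qed
  then show ?thesis by (simp add: fps_eq_iff)
qed

text \<open>
  The library has the product and chain rules for composition over integral domains only, but the
  ring of formal power series in countably many variables is not known to be one.
\<close>

lemma fps_compose_X_mult:
  fixes f v :: "'a::comm_ring_1 fps"
  assumes "v $ 0 = 0"
  shows "(fps_X * f) oo v = v * (f oo v)"
proof (rule fps_ext)
  fix n
  have "(v * (f oo v)) $ n = (\<Sum>j = 0..n. \<Sum>i = 0..n. f $ i * (v $ j * v ^ i $ (n - j)))"
    unfolding fps_mult_nth fps_compose_nth sum_distrib_left
  proof (rule sum.cong [OF refl])
    fix j assume "j \<in> {0..n}"
    show "(\<Sum>i = 0..n - j. v $ j * (f $ i * v ^ i $ (n - j))) =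
        (\<Sum>i = 0..n. f $ i * (v $ j * v ^ i $ (n - j)))"
      by (rule sum.mono_neutral_cong_left)
         (auto simp: startsby_zero_power_prefix [OF assms] algebra_simps)
  qed
  also have "\<dots> = (\<Sum>i = 0..n. f $ i * (v ^ Suc i) $ n)"
    by (subst sum.swap) (simp add: fps_mult_nth sum_distrib_left)
  also have "\<dots> = (\<Sum>i = 0..<n. f $ i * (v ^ Suc i) $ n)"
    using startsby_zero_power_prefix [OF assms, of "Suc n"]
    by (simp add: atLeastLessThanSuc_atLeastAtMost [symmetric] del: power_Suc)
  also have "\<dots> = ((fps_X * f) oo v) $ n"
  proof (cases n)
    case (Suc m)
    show ?thesis
      unfolding fps_compose_nth Suc sum.atLeast0_atMost_Suc_shift
      by (simp add: atLeastLessThanSuc_atLeastAtMost del: power_Suc)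
  qed simp
  finally show "((fps_X * f) oo v) $ n = (v * (f oo v)) $ n" ..
qed

lemma fps_eq_const_plus_shift: "f = fps_const (f $ 0) + fps_X * fps_shift 1 f"
  for f :: "'a::comm_ring_1 fps"
  by (rule fps_ext) (auto simp: fps_X_mult_nth)

lemma fps_compose_const_mult: "(fps_const c * f) oo v = fps_const c * (f oo v)"
  for f :: "'a::comm_ring_1 fps"
  by (rule fps_ext) (simp add: fps_compose_nth sum_distrib_left mult.assoc)

text \<open>Splitting off the constant term of \<open>f\<close> shows that the defect of
  multiplicativity satisfies \<open>d f = v * d (fps_shift 1 f)\<close>, so it vanishes by
  contraction.\<close>

lemma fps_compose_mult:
  fixes f h v :: "'a::comm_ring_1 fps"
  assumes "v $ 0 = 0"
  shows "(f * h) oo v = (f oo v) * (h oo v)"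
proof -
  define d where "d f = ((f * h) oo v) - (f oo v) * (h oo v)" for f
  have "d f = v * d (fps_shift 1 f)" for f
  proof -
    let ?r = "fps_shift 1 f"
    have "f * h = fps_const (f $ 0) * h + fps_X * (?r * h)"
      by (subst fps_eq_const_plus_shift [of f]) (simp add: algebra_simps)
    then have "(f * h) oo v = fps_const (f $ 0) * (h oo v) + v * ((?r * h) oo v)"
      by (simp add: fps_compose_add_distrib fps_compose_X_mult assms fps_compose_const_mult)
    moreover have "f oo v = fps_const (f $ 0) + v * (?r oo v)"
      by (subst fps_eq_const_plus_shift [of f])
         (simp add: fps_compose_add_distrib fps_compose_X_mult assms)
    ultimately show ?thesis by (simp add: d_def algebra_simps)
  qed
  then have "d f = 0"
    using assms by (rule fps_eq_0_if_contracting)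
  then show ?thesis by (simp add: d_def)
qed

lemma fps_compose_pow: "v $ 0 = 0 \<Longrightarrow> (f ^ n) oo v = (f oo v) ^ n"
  for f v :: "'a::comm_ring_1 fps"
  by (induction n) (simp_all add: fps_compose_mult)

lemma fps_deriv_compose:
  fixes f v :: "'a::comm_ring_1 fps"
  assumes "v $ 0 = 0"
  shows "fps_deriv (f oo v) = (fps_deriv f oo v) * fps_deriv v"
proof -
  define d where "d f = fps_deriv (f oo v) - (fps_deriv f oo v) * fps_deriv v" for f
  have "d f = v * d (fps_shift 1 f)" for f
  proof -
    let ?r = "fps_shift 1 f"
    have f: "f = fps_const (f $ 0) + fps_X * ?r" by (rule fps_eq_const_plus_shift)
    have "f oo v = fps_const (f $ 0) + v * (?r oo v)"
      by (subst f) (simp add: fps_compose_add_distrib fps_compose_X_mult assms)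
    then have "fps_deriv (f oo v) = v * fps_deriv (?r oo v) + fps_deriv v * (?r oo v)"
      by simp
    moreover have "fps_deriv f = fps_X * fps_deriv ?r + ?r"
      by (subst f) simp
    then have "fps_deriv f oo v = v * (fps_deriv ?r oo v) + (?r oo v)"
      by (simp add: fps_compose_add_distrib fps_compose_X_mult assms)
    ultimately show ?thesis by (simp add: d_def algebra_simps)
  qed
  then have "d f = 0"
    using assms by (rule fps_eq_0_if_contracting)
  then show ?thesis by (simp add: d_def)
qed

lemma fps_geometric_mult:
  "(1 + fps_const s * fps_X) * Abs_fps (\<lambda>i. (- s) ^ i) = (1 :: 'a::comm_ring_1 fps)"
proof (rule fps_ext)
  fix n
  show "((1 + fps_const s * fps_X) * Abs_fps (\<lambda>i. (- s) ^ i)) $ n = 1 $ n"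
    by (cases n) (simp_all add: distrib_right mult.assoc)
qed

text \<open>For \<open>a = 0\<close> the truncated subtraction gives \<open>i - 1 choose i\<close>, which is \<open>1\<close> at \<open>i = 0\<close> and \<open>0\<close> otherwise.\<close>

lemma fps_geometric_power_nth:
  "(Abs_fps (\<lambda>i. (- s) ^ i) ^ a) $ i = (- s :: 'a::comm_ring_1) ^ i * of_nat ((a + i - 1) choose i)"
proof -
  define B where "B a = Abs_fps (\<lambda>i. (- s) ^ i * of_nat ((a + i - 1) choose i))" for a
  let ?A = "1 + fps_const s * fps_X" and ?g = "Abs_fps (\<lambda>i. (- s) ^ i)"
  \<comment> \<open>Pascal's rule: multiplying by \<open>1 + s z\<close> lowers the exponent by one.
    As \<open>?g\<close> inverts this factor, \<open>B\<close> obeys the recurrence of the powers of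
    \<open>?g\<close>.\<close>
  have A: "?A * B (Suc a) = B a" for a
  proof (rule fps_ext)
    fix i
    show "(?A * B (Suc a)) $ i = B a $ i"
    proof (cases i)
      case (Suc j)
      have "Suc a + Suc j - 1 choose Suc j = (a + j choose j) + (a + j choose Suc j)"
        by simp
      then show ?thesis
        by (simp add: Suc B_def distrib_right mult.assoc algebra_simps)
    qed (simp add: B_def distrib_right mult.assoc)
  qed
  have "B (Suc a) = ?g * B a" for a
  proof -
    have "?g * B a = ?g * (?A * B (Suc a))"
      by (simp only: A)
    also have "\<dots> = (?A * ?g) * B (Suc a)"
      by (simp only: ac_simps)
    finally show ?thesis by (simp add: fps_geometric_mult)
  qed
  moreover have "B 0 = 1"
    by (rule fps_ext) (auto simp: B_def binomial_eq_0)
  ultimately have "?g ^ a = B a"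
    by (induction a) simp_all
  then show ?thesis by (simp add: B_def)
qed

section \<open>The pan generating function\<close>

text \<open>The algebra, detached from words: \<open>p k\<close> will be the power sum of degree
  \<open>k + 1\<close>, while \<open>H\<close>, \<open>U\<close> and \<open>M\<close> stand for
  star, path and cycle words whose first letter has \<open>k\<close> extra copies, and
  \<open>Q\<close> for words without equal neighbours. \<open>M k 0\<close> is left open.\<close>

locale pan_recurrences =
  fixes p :: "nat \<Rightarrow> 'a::comm_ring_1" and H U M :: "nat \<Rightarrow> nat \<Rightarrow> 'a" and Q :: "nat \<Rightarrow> 'a"
  assumes H: "H k 0 = p k" "H k (Suc j) = p 0 * H k j - H (Suc k) j"
    and U: "U k 0 = p k" "U k (Suc j) = p k * Q (Suc j) - U (Suc k) j"
    and Q: "Q 0 = 1" "Q (Suc n) = U 0 n"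
    and M: "M k (Suc 0) = 0" "M k (Suc (Suc n)) = U k (Suc n) - M (Suc k) (Suc n)"
begin

definition "A = 1 + fps_const (p 0) * fps_X"
definition "g = Abs_fps (\<lambda>i. (- p 0) ^ i)"
definition "u = fps_X * g"
text \<open>\<open>H 0 (k - 1)\<close> is the star on \<open>k\<close> vertices. The one-vertex star
  is left out because it enters separately, as \<open>p 0\<close>.\<close>

definition "T = Abs_fps (\<lambda>k. if k < 2 then 0 else H 0 (k - 1))"
definition "V = A * (T oo u)"

lemma u0: "u $ 0 = 0"
  by (simp add: u_def)

lemma Ag: "A * g = 1"
  by (simp only: A_def g_def fps_geometric_mult)

lemma deriv_g: "fps_deriv g = - (fps_const (p 0) * g * g)"
proof -
  have "fps_deriv (A * g) = 0" by (simp add: Ag)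
  then have "A * fps_deriv g + fps_const (p 0) * g = 0" by (simp add: A_def)
  then have "g * (A * fps_deriv g + fps_const (p 0) * g) = 0" by simp
  then have "(A * g) * fps_deriv g + fps_const (p 0) * g * g = 0" by (simp add: algebra_simps)
  then show ?thesis by (simp add: Ag eq_neg_iff_add_eq_0)
qed

lemma pan_generating_function:
  obtains R where "R * (1 - V) = 1"
    and "\<And>n. n \<ge> 2 \<Longrightarrow>
      p 0 * M 0 (n - 1) - M 1 (n - 1) = (A * fps_X * R * fps_deriv V - V - A * R) $ n"
proof -
  define s where "s = p 0"
  define q where "q = Abs_fps Q"
  define h where "h k = Abs_fps (H k)" for k
  define y where "y k = Abs_fps (U k)" for k
  \<comment> \<open>Index \<open>0\<close> is set to \<open>0\<close> because the locale does not
    determine \<open>M k 0\<close>.\<close>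
  define m where "m k = Abs_fps (\<lambda>n. if n = 0 then 0 else M k n)" for k
  have h: "h k = fps_const (p k) + fps_X * (fps_const s * h k - h (Suc k))" for k
  proof (rule fps_ext)
    fix n show "h k $ n = (fps_const (p k) + fps_X * (fps_const s * h k - h (Suc k))) $ n"
      by (cases n) (simp_all add: h_def H s_def)
  qed
  have y: "y k = fps_const (p k) * q - fps_X * y (Suc k)" for k
  proof (rule fps_ext)
    fix n show "y k $ n = (fps_const (p k) * q - fps_X * y (Suc k)) $ n"
      by (cases n) (simp_all add: y_def q_def U Q)
  qed
  have q: "q = 1 + fps_X * y 0"
  proof (rule fps_ext)
    fix n show "q $ n = (1 + fps_X * y 0) $ n"
      by (cases n) (simp_all add: y_def q_def Q)
  qed
  have m: "m k = fps_X * (y k - fps_const (p k)) - fps_X * m (Suc k)" for k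
  proof (rule fps_ext)
    fix n show "m k $ n = (fps_X * (y k - fps_const (p k)) - fps_X * m (Suc k)) $ n"
    proof (cases n)
      case (Suc j)
      then show ?thesis by (cases j) (simp_all add: y_def m_def M U)
    qed (simp add: m_def)
  qed
  have su: "1 - fps_const s * u = g"
    using Ag by (simp add: u_def A_def s_def algebra_simps)

  \<comment> \<open>Composition with \<open>u\<close> replaces the factor \<open>1 - s z\<close> of
    the star recurrence by \<open>1 - s u = g\<close>, and \<open>u = z g\<close>. The extra
    \<open>g\<close> then leaves a recurrence free of \<open>s\<close>.\<close>
  define P where "P k = g * (h k oo u)" for k
  have P: "P k = fps_const (p k) - fps_X * P (Suc k)" for k
  proof -
    have "h k oo u = fps_const (p k) + u * (fps_const s * (h k oo u) - (h (Suc k) oo u))"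
      by (subst h) (simp add: fps_compose_add_distrib fps_compose_sub_distrib fps_compose_X_mult
          u0 fps_compose_const_mult)
    then have "(1 - fps_const s * u) * (h k oo u) = fps_const (p k) - u * (h (Suc k) oo u)"
      by (simp add: algebra_simps)
    then show ?thesis by (simp add: su P_def) (simp add: u_def algebra_simps)
  qed
  \<comment> \<open>The derivative weights the term \<open>(- z)^i * p (k + i)\<close> of
    \<open>P k\<close> by \<open>i + 1\<close>. Iterating the recurrence of \<open>m\<close>
    produces the same weights, as it sums \<open>(- z)^i * P (k + i)\<close>.\<close>
  define K where "K k = fps_deriv (fps_X * P k)" for k
  have K: "K k = P k - fps_X * K (Suc k)" for k
  proof -
    have "fps_deriv (P k) = - K (Suc k)"
      by (subst P) (simp add: K_def)
    moreover have "K k = P k + fps_X * fps_deriv (P k)"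
      by (simp add: K_def)
    ultimately show ?thesis by simp
  qed
  have yP: "y k = q * P k" for k
  proof -
    have "y k - q * P k = (- fps_X) * (y (Suc k) - q * P (Suc k))" for k
      by (subst y, subst P) (simp add: algebra_simps)
    then have "y k - q * P k = 0"
      by (rule fps_eq_0_if_contracting [where \<sigma> = Suc]) simp
    then show ?thesis by simp
  qed
  have mK: "m k = fps_X * (q * K k) - fps_X * P k" for k
  proof -
    have "m k - (fps_X * (q * K k) - fps_X * P k) =
        (- fps_X) * (m (Suc k) - (fps_X * (q * K (Suc k)) - fps_X * P (Suc k)))" for k
      by (subst m, subst K, subst (2) P) (simp add: yP algebra_simps)
    then have "m k - (fps_X * (q * K k) - fps_X * P k) = 0"
      by (rule fps_eq_0_if_contracting [where \<sigma> = Suc]) simp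
    then show ?thesis by simp
  qed

  define W where "W = T oo u"
  define R where "R = g * q"
  have VW: "V = A * W" by (simp add: V_def W_def u_def)
  have gV: "g * V = W"
    using Ag by (simp add: VW mult.assoc [symmetric] mult.commute [of g])
  have XP: "fps_X * P 0 = fps_const s * u + W"
  proof -
    have "fps_X * h 0 = fps_const s * fps_X + T"
    proof (rule fps_ext)
      fix n show "(fps_X * h 0) $ n = (fps_const s * fps_X + T) $ n"
      proof (cases n)
        case (Suc j)
        then show ?thesis by (cases j) (simp_all add: T_def h_def H s_def)
      qed (simp add: T_def)
    qed
    then have "(fps_X * h 0) oo u = (fps_const s * fps_X + T) oo u" by simp
    then have "u * (h 0 oo u) = fps_const s * u + W"
      by (simp add: fps_compose_add_distrib fps_compose_X_mult u0 fps_compose_const_mult W_def)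
    then show ?thesis by (simp add: P_def u_def algebra_simps)
  qed
  have XP': "fps_X * P 0 = 1 - g * (1 - V)"
    by (simp add: XP right_diff_distrib gV) (simp add: su [symmetric])
  have R1: "R * (1 - V) = 1"
  proof -
    have "q * (1 - fps_X * P 0) = 1"
      using q by (simp add: yP algebra_simps)
    moreover have "1 - fps_X * P 0 = g * (1 - V)"
      by (simp add: XP')
    ultimately show ?thesis by (simp add: R_def mult.assoc mult.left_commute)
  qed
  have qR: "q = A * R"
    using Ag by (simp add: R_def mult.assoc [symmetric])
  have qK: "q * K 0 = R * fps_deriv V + fps_const s * g"
  proof -
    have K0: "K 0 = g * fps_deriv V + fps_const s * g * g * (1 - V)"
      unfolding K_def XP' by (simp add: deriv_g s_def algebra_simps)
    have "q * K 0 = (A * g) * (R * fps_deriv V) + (A * g) * (fps_const s * g) * (R * (1 - V))"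
      by (simp only: qR K0) (simp only: distrib_left ac_simps)
    then show ?thesis by (simp add: Ag R1)
  qed
  have m0: "m 0 = fps_X * R * fps_deriv V - W"
    by (simp add: mK qK XP) (simp add: u_def algebra_simps)
  have "fps_X * (fps_const s * m 0 - m 1) = A * m 0 - q + A"
  proof -
    \<comment> \<open>The recurrence at \<open>k = 0\<close> expresses \<open>z * m 1\<close>
      through \<open>m 0\<close>, which is already solved.\<close>
    have "fps_X * m 1 = fps_X * y 0 - fps_X * fps_const s - m 0"
      using m [of 0] by (simp add: s_def algebra_simps)
    then have "fps_X * (fps_const s * m 0 - m 1) = A * m 0 - fps_X * y 0 + fps_const s * fps_X"
      by (simp add: A_def s_def algebra_simps)
    then show ?thesis using q by (simp add: A_def s_def)
  qed
  also have "\<dots> = A * fps_X * R * fps_deriv V - V - A * R + A"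
    by (simp add: m0 VW qR algebra_simps)
  finally have F: "fps_X * (fps_const s * m 0 - m 1) =
    A * fps_X * R * fps_deriv V - V - A * R + A" .
  have "p 0 * M 0 (n - 1) - M 1 (n - 1) = (A * fps_X * R * fps_deriv V - V - A * R) $ n"
    if "n \<ge> 2" for n
  proof -
    have "A $ n = 0" using that by (simp add: A_def fps_X_def)
    moreover have "(fps_X * (fps_const s * m 0 - m 1)) $ n = p 0 * M 0 (n - 1) - M 1 (n - 1)"
      using that by (simp add: m_def s_def)
    ultimately show ?thesis by (simp only: F fps_add_nth fps_sub_nth) simp
  qed
  with R1 show ?thesis by (rule that)
qed


text \<open>As \<open>u = z g\<close> and \<open>A * g = 1\<close>, the product
  \<open>A ^ j * u ^ N\<close> collapses to \<open>z ^ N * g ^ (N - j)\<close> for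
  \<open>N \<ge> j\<close>, whose coefficients are negative binomial ones. The assumption on
  \<open>f\<close> removes all \<open>N < j\<close>, where the subtraction would truncate.\<close>

lemma compose_u_power_nth:
  assumes "\<And>N. N < j \<Longrightarrow> f $ N = 0"
  shows "(A ^ j * (f oo u)) $ n =
    (\<Sum>N = 0..n. f $ N * ((- p 0) ^ (n - N) * of_nat ((N - j + (n - N) - 1) choose (n - N))))"
proof -
  have "(f oo u) $ i = (\<Sum>N = 0..n. f $ N * u ^ N $ i)" if "i \<le> n" for i
    unfolding fps_compose_nth using that
    by (intro sum.mono_neutral_left) (auto simp: startsby_zero_power_prefix [OF u0])
  then have "(A ^ j * (f oo u)) $ n = (\<Sum>i = 0..n. A ^ j $ i * (\<Sum>N = 0..n. f $ N * u ^ N $ (n - i)))"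
    by (simp add: fps_mult_nth)
  also have "\<dots> = (\<Sum>N = 0..n. f $ N * (A ^ j * u ^ N) $ n)"
    unfolding fps_mult_nth sum_distrib_left by (subst sum.swap) (simp add: ac_simps)
  also have "\<dots> = (\<Sum>N = 0..n. f $ N * ((- p 0) ^ (n - N) * of_nat ((N - j + (n - N) - 1) choose (n - N))))"
  proof (rule sum.cong [OF refl])
    fix N assume N: "N \<in> {0..n}"
    show "f $ N * (A ^ j * u ^ N) $ n =
      f $ N * ((- p 0) ^ (n - N) * of_nat ((N - j + (n - N) - 1) choose (n - N)))"
    proof (cases "N < j")
      case False
      have "A ^ j * u ^ N = fps_X ^ N * ((A * g) ^ j * g ^ (N - j))"
        using False by (simp add: u_def power_mult_distrib power_add [symmetric] ac_simps)
      then have "(A ^ j * u ^ N) $ n = (g ^ (N - j)) $ (n - N)"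
        using N by (simp add: Ag fps_X_power_mult_nth)
      then show ?thesis
        by (simp only: g_def fps_geometric_power_nth)
    qed (simp add: assms)
  qed
  finally show ?thesis .
qed

lemma pow_T_nth_eq_0: "N < j \<Longrightarrow> (T ^ j) $ N = 0"
  by (rule startsby_zero_power_prefix [rule_format]) (simp_all add: T_def)

text \<open>Only the multiple \<open>of_nat j * t j n\<close> is described, since the ring need not
  permit division by \<open>j\<close>. The subtracted sum is the coefficient of
  \<open>V\<close>.\<close>

lemma pan_coefficient:
  obtains t where
    "\<And>n. n \<ge> 2 \<Longrightarrow> p 0 * M 0 (n - 1) - M 1 (n - 1) = (\<Sum>j = 1..n. t j n) -
      (\<Sum>N = 0..n. T $ N * ((- p 0) ^ (n - N) * of_nat ((N - 1 + (n - N) - 1) choose (n - N))))"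
    "\<And>j n. of_nat j * t j n = (\<Sum>N = 0..n. (of_nat N - of_nat j) * (T ^ j) $ N *
      ((- p 0) ^ (n - N) * of_nat ((N - j + (n - N) - 1) choose (n - N))))"
proof -
  obtain R where R: "R * (1 - V) = 1"
    and F: "\<And>n. n \<ge> 2 \<Longrightarrow>
      p 0 * M 0 (n - 1) - M 1 (n - 1) = (A * fps_X * R * fps_deriv V - V - A * R) $ n"
    by (rule pan_generating_function) blast
  define t where "t j = A * (fps_X * V ^ (j - 1) * fps_deriv V - V ^ j)" for j
  have V0: "V $ 0 = 0"
    by (simp add: V_def T_def)
  have "(A * fps_X * R * fps_deriv V - A * R) $ n = (\<Sum>j = 1..n. t j $ n)" if "n \<ge> 2" for n
  proof -
    have R_sum: "R = (\<Sum>j<k. V ^ j) + V ^ k * R" for k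
    proof (induction k)
      case (Suc k)
      have "R = 1 + V * R" using R by (simp add: algebra_simps)
      then have "V ^ k * R = V ^ k * (1 + V * R)" by simp
      then have "V ^ k * R = V ^ k + V ^ Suc k * R" by (simp add: algebra_simps)
      moreover have "R = (\<Sum>j<k. V ^ j) + V ^ k * R" by (rule Suc)
      ultimately show ?case by (simp only: sum.lessThan_Suc add.assoc)
    qed simp
    have "(\<Sum>j<n. V ^ j) = (\<Sum>j = 1..n. V ^ (j - 1))"
      by (rule sum.reindex_bij_witness [where i = "\<lambda>j. j - 1" and j = Suc]) auto
    \<comment> \<open>The cut-offs differ, \<open>n\<close> here and \<open>Suc n\<close> in
      \<open>R2\<close>, so that \<open>V ^ (j - 1)\<close> and \<open>V ^ j\<close> pair up for
      \<open>j = 1, ..., n\<close>. Both remainders have order above \<open>n\<close>.\<close>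
    then have R1: "R = (\<Sum>j = 1..n. V ^ (j - 1)) + V ^ n * R"
      by (metis R_sum)
    have "(\<Sum>j<Suc n. V ^ j) = 1 + (\<Sum>j = 1..n. V ^ j)"
      by (simp add: lessThan_Suc_atMost atMost_atLeast0 sum.atLeast_Suc_atMost)
    then have R2: "R = 1 + (\<Sum>j = 1..n. V ^ j) + V ^ Suc n * R"
      by (metis R_sum)
    have "A * fps_X * R * fps_deriv V - A * R =
        A * fps_X * ((\<Sum>j = 1..n. V ^ (j - 1)) + V ^ n * R) * fps_deriv V
        - A * (1 + (\<Sum>j = 1..n. V ^ j) + V ^ Suc n * R)"
      by (rule arg_cong2 [where f = "\<lambda>a b. A * fps_X * a * fps_deriv V - A * b", OF R1 R2])
    also have "\<dots> = (\<Sum>j = 1..n. t j) - A + fps_X * V ^ n * (A * R * fps_deriv V) - V ^ Suc n * (A * R)"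
      by (simp add: t_def sum_subtractf sum_distrib_left sum_distrib_right algebra_simps)
    finally have *: "A * fps_X * R * fps_deriv V - A * R =
      (\<Sum>j = 1..n. t j) - A + fps_X * V ^ n * (A * R * fps_deriv V) - V ^ Suc n * (A * R)" .
    have "V ^ n $ i = 0" if "i < n" for i
      using startsby_zero_power_prefix [OF V0] that by blast
    then have "(fps_X * V ^ n) $ i = 0" if "i \<le> n" for i
      using that by auto
    then have "(fps_X * V ^ n * (A * R * fps_deriv V)) $ n = 0"
      by (simp only: fps_mult_nth [of "fps_X * V ^ n"]) simp
    moreover have "(V ^ Suc n * (A * R)) $ n = 0"
      using startsby_zero_power_prefix [OF V0, of "Suc n"] by (simp only: fps_mult_nth [of "V ^ Suc n"]) simp
    moreover have "A $ n = 0" using that by (simp add: A_def)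
    ultimately show ?thesis by (simp add: * fps_sum_nth)
  qed
  moreover have "V $ n =
    (\<Sum>N = 0..n. T $ N * ((- p 0) ^ (n - N) * of_nat ((N - 1 + (n - N) - 1) choose (n - N))))" for n
    using compose_u_power_nth [of 1 T n] by (simp add: V_def T_def)
  ultimately have 1: "p 0 * M 0 (n - 1) - M 1 (n - 1) = (\<Sum>j = 1..n. t j $ n) -
      (\<Sum>N = 0..n. T $ N * ((- p 0) ^ (n - N) * of_nat ((N - 1 + (n - N) - 1) choose (n - N))))"
    if "n \<ge> 2" for n
    using that F [of n] by (simp add: algebra_simps)

  \<comment> \<open>In \<open>A * (z V' - V)\<close> with \<open>V = A * W\<close>, the terms in
    \<open>W\<close> add up to \<open>- A * W\<close>, because \<open>A * s z - A * A = - A\<close>.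
    With \<open>z = A * u\<close>, the operator \<open>z d/dz\<close> acting on \<open>V\<close>
    thus becomes the same operator acting on \<open>T\<close>, evaluated at
    \<open>u\<close>.\<close>
  have "of_nat j * t j = A ^ j * ((fps_X * fps_deriv (T ^ j) - of_nat j * T ^ j) oo u)" for j
  proof (cases j)
    case (Suc i)
    define W where "W = T oo u"
    have du: "fps_deriv u = g * g"
    proof -
      have "fps_deriv u = g * (1 - fps_const (p 0) * fps_X * g)"
        by (simp add: u_def deriv_g algebra_simps)
      also have "1 - fps_const (p 0) * fps_X * g = g"
        using Ag by (simp add: A_def algebra_simps)
      finally show ?thesis .
    qed
    have dW: "fps_deriv W = (fps_deriv T oo u) * (g * g)"
      by (simp add: W_def fps_deriv_compose u0 du)
    have dV: "fps_deriv V = fps_const (p 0) * W + A * fps_deriv W"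
      by (simp add: V_def W_def [symmetric]) (simp add: A_def)
    have "A * fps_X * (A * fps_deriv W) = (A * g) * (A * g) * (fps_X * (fps_deriv T oo u))"
      by (simp only: dW ac_simps)
    then have **: "A * (fps_X * fps_deriv V - V) = A * fps_X * fps_const (p 0) * W - A * A * W
         + fps_X * (fps_deriv T oo u)"
      by (simp only: Ag V_def W_def [symmetric] dV [unfolded V_def W_def [symmetric]])
         (simp add: algebra_simps)
    also have "\<dots> = fps_X * (fps_deriv T oo u) - A * W"
      by (simp add: A_def algebra_simps)
    finally have "A * (fps_X * fps_deriv V - V) = fps_X * (fps_deriv T oo u) - A * W" .
    moreover have "t j = V ^ i * (A * (fps_X * fps_deriv V - V))"
      by (simp add: t_def Suc algebra_simps)
    ultimately have "t j = V ^ i * (fps_X * (fps_deriv T oo u) - A * W)"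
      by simp
    moreover have "V ^ i * fps_X = A ^ j * W ^ i * u"
    proof -
      have "A ^ j * W ^ i * u = (A * g) * (A ^ i * W ^ i * fps_X)"
        by (simp add: Suc u_def ac_simps)
      then show ?thesis by (simp add: Ag V_def W_def power_mult_distrib)
    qed
    then have "V ^ i * (fps_X * (fps_deriv T oo u)) = A ^ j * W ^ i * u * (fps_deriv T oo u)"
      by (simp only: mult.assoc [symmetric])
    moreover have "V ^ i * (A * W) = A ^ j * W ^ j"
      by (simp add: Suc V_def W_def power_mult_distrib ac_simps)
    ultimately have "t j = A ^ j * (W ^ i * u * (fps_deriv T oo u) - W ^ j)"
      by (simp add: algebra_simps)
    moreover have "(fps_X * fps_deriv (T ^ j) - of_nat j * T ^ j) oo u =
      of_nat j * (W ^ i * u * (fps_deriv T oo u) - W ^ j)"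
      by (simp add: Suc fps_deriv_power' fps_compose_sub_distrib fps_compose_X_mult fps_compose_mult
          fps_compose_pow u0 fps_of_nat [symmetric] W_def algebra_simps del: power_Suc of_nat_Suc)
    ultimately show ?thesis
      by (simp only: ac_simps)
  qed (simp add: t_def)
  note tj = this
  have 2: "of_nat j * t j $ n = (\<Sum>N = 0..n. (of_nat N - of_nat j) * (T ^ j) $ N *
      ((- p 0) ^ (n - N) * of_nat ((N - j + (n - N) - 1) choose (n - N))))" for j n
  proof -
    \<comment> \<open>The factor \<open>N - j\<close> arises here. Later \<open>N\<close> is
      \<open>n\<close> minus the number of ones and \<open>j\<close> is the number of parts above
      one, so that \<open>(N - j) / j\<close> is the fraction of the non-hook formula.\<close>
    have *: "(fps_X * fps_deriv (T ^ j) - of_nat j * T ^ j) $ N = (of_nat N - of_nat j) * (T ^ j) $ N" for N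
      by (cases N) (simp_all add: fps_of_nat [symmetric] algebra_simps del: of_nat_Suc)
    have "of_nat j * t j $ n = (A ^ j * ((fps_X * fps_deriv (T ^ j) - of_nat j * T ^ j) oo u)) $ n"
      by (metis tj fps_mult_left_const_nth fps_of_nat)
    then show ?thesis
      by (subst (asm) compose_u_power_nth) (simp_all only: * pow_T_nth_eq_0 mult_zero_right)
  qed
  show ?thesis by (rule that [OF 1 2])
qed

end

section \<open>Symmetric functions as generating functions of words\<close>

text \<open>Listing the colours in vertex order turns a colouring into a word. Only the content of
  the word is recorded, so moving letters around, as \<open>rotate1\<close> does, changes
  nothing.\<close>

definition word_sf :: "nat list set \<Rightarrow> rat mfps" where
  "word_sf L = Abs_mfps (\<lambda>m. of_nat (card {xs \<in> L. mset xs = m}))"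

lemma finite_words_of_monomial [simp]: "finite {xs \<in> L. mset xs = m}"
  by (rule finite_subset [OF _ finite_permutations_of_multiset [of m]])
     (auto simp: permutations_of_multiset_def)

lemma coeff_plus_mfps [simp]: "mfps_coeff (f + g) m = mfps_coeff f m + mfps_coeff g m"
  for f g :: "'a::comm_ring_1 mfps"
  by transfer simp

lemma coeff_times_mfps:
  "mfps_coeff (f * g) m = (\<Sum>(a, b) \<in> {(a, b). a + b = m}. mfps_coeff f a * mfps_coeff g b)"
  for f g :: "'a::comm_ring_1 mfps"
  by transfer simp

lemma word_sf_Un: "A \<inter> B = {} \<Longrightarrow> word_sf (A \<union> B) = word_sf A + word_sf B"
proof (rule mfps_eqI)
  fix m assume "A \<inter> B = {}"
  then have "card ({xs \<in> A. mset xs = m} \<union> {xs \<in> B. mset xs = m}) =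
      card {xs \<in> A. mset xs = m} + card {xs \<in> B. mset xs = m}"
    by (intro card_Un_disjoint) auto
  moreover have "{xs \<in> A \<union> B. mset xs = m} = {xs \<in> A. mset xs = m} \<union> {xs \<in> B. mset xs = m}"
    by auto
  ultimately show "mfps_coeff (word_sf (A \<union> B)) m = mfps_coeff (word_sf A + word_sf B) m"
    by (simp add: word_sf_def)
qed

lemma word_sf_image:
  assumes "inj_on f A" "\<And>xs. xs \<in> A \<Longrightarrow> mset (f xs) = mset xs"
  shows "word_sf (f ` A) = word_sf A"
proof (rule mfps_eqI)
  fix m
  have "{ys \<in> f ` A. mset ys = m} = f ` {xs \<in> A. mset xs = m}"
    using assms(2) by auto
  moreover have "inj_on f {xs \<in> A. mset xs = m}"
    using assms(1) by (rule inj_on_subset) auto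
  ultimately show "mfps_coeff (word_sf (f ` A)) m = mfps_coeff (word_sf A) m"
    by (simp add: word_sf_def card_image)
qed

lemma word_sf_rotate1: "word_sf (rotate1 ` A) = word_sf A"
proof (rule word_sf_image)
  show "inj_on rotate1 A"
    by (rule inj_on_subset [OF inj_rotate1]) simp
  show "mset (rotate1 xs) = mset xs" for xs :: "nat list"
    by (cases xs) simp_all
qed

text \<open>The common length \<open>k\<close> tells where a concatenation is to be cut, so every
  word of the left-hand side arises from a single pair.\<close>

lemma word_sf_append:
  assumes "\<And>xs. xs \<in> A \<Longrightarrow> length xs = k"
  shows "word_sf {xs @ ys | xs ys. xs \<in> A \<and> ys \<in> B} = word_sf A * word_sf B"
proof (rule mfps_eqI)
  fix m
  let ?W = "\<lambda>L a. {xs \<in> L. mset xs = a}"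
  let ?D = "{(a, b). a + b = (m :: nat multiset)}"
  have "bij_betw (\<lambda>(_, xs, ys). xs @ ys) (SIGMA (a, b) : ?D. ?W A a \<times> ?W B b)
      (?W {xs @ ys | xs ys. xs \<in> A \<and> ys \<in> B} m)"
    by (rule bij_betwI [where g = "\<lambda>zs. ((mset (take k zs), mset (drop k zs)), take k zs, drop k zs)"])
       (auto simp: assms)
  then have "card (?W {xs @ ys | xs ys. xs \<in> A \<and> ys \<in> B} m) =
      card (SIGMA (a, b) : ?D. ?W A a \<times> ?W B b)"
    by (simp only: bij_betw_same_card)
  also have "\<dots> = (\<Sum>(a, b) \<in> ?D. card (?W A a) * card (?W B b))"
    by (subst card_SigmaI) (auto simp: finite_mset_decomps [unfolded case_prod_unfold] card_cartesian_product split_def intro!: sum.cong)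
  finally show "mfps_coeff (word_sf {xs @ ys | xs ys. xs \<in> A \<and> ys \<in> B}) m =
      mfps_coeff (word_sf A * word_sf B) m"
    by (simp add: word_sf_def coeff_times_mfps split_def)
qed

text \<open>
  In the following words the first letter carries \<open>k\<close> additional copies. All of them then have
  positive multiplicity, so that no infinite sum \<open>p\<^sub>0\<close> of ones arises.
\<close>

definition power_sf :: "nat \<Rightarrow> rat mfps" where
  "power_sf k = word_sf (range (replicate (Suc k)))"

definition star_words :: "nat \<Rightarrow> nat \<Rightarrow> nat list set" where
  "star_words k j = {replicate (Suc k) c @ ys | c ys. length ys = j \<and> c \<notin> set ys}"

definition path_words :: "nat \<Rightarrow> nat \<Rightarrow> nat list set" where
  "path_words k j = {replicate (Suc k) c @ ys | c ys. length ys = j \<and> distinct_adj (c # ys)}"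

definition cycle_words :: "nat \<Rightarrow> nat \<Rightarrow> nat list set" where
  "cycle_words k n =
     {replicate k (hd ys) @ ys | ys. length ys = n \<and> distinct_adj ys \<and> hd ys \<noteq> last ys}"

lemma star_words_0: "word_sf (star_words k 0) = power_sf k"
  by (simp add: power_sf_def star_words_def full_SetCompr_eq del: replicate_Suc)

lemma image_setcompr: "f ` {h x y | x y. P x y} = {f (h x y) | x y. P x y}"
  by blast

text \<open>The factor \<open>power_sf 0\<close> appends an arbitrary letter. If it differs from the
  centre's letter, the star has grown; if not, moving it to the front yields one more copy.\<close>

lemma star_words_Suc:
  "word_sf (star_words k (Suc j)) =
     power_sf 0 * word_sf (star_words k j) - word_sf (star_words (Suc k) j)"
proof -
  let ?S = "{replicate (Suc k) c @ ys @ [c] | (c :: nat) ys. length ys = j \<and> c \<notin> set ys}"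
  have single: "[d] \<in> range (replicate 1)" for d :: nat
    by (metis One_nat_def rangeI replicate_0 replicate_Suc)
  have "{xs @ zs | xs zs. xs \<in> star_words k j \<and> zs \<in> range (replicate 1)} = star_words k (Suc j) \<union> ?S"
  proof (intro Set.set_eqI iffI)
    fix w assume "w \<in> {xs @ zs | xs zs. xs \<in> star_words k j \<and> zs \<in> range (replicate 1)}"
    then obtain c ys d where "w = replicate (Suc k) c @ ys @ [d]" "length ys = j" "c \<notin> set ys"
      by (auto simp: star_words_def)
    then show "w \<in> star_words k (Suc j) \<union> ?S"
      by (cases "c = d") (force simp: star_words_def simp del: replicate_Suc)+
  next
    fix w assume "w \<in> star_words k (Suc j) \<union> ?S"
    then consider c ys where "w = replicate (Suc k) c @ ys" "length ys = Suc j" "c \<notin> set ys"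
      | c ys where "w = replicate (Suc k) c @ ys @ [c]" "length ys = j" "c \<notin> set ys"
      by (auto simp: star_words_def simp del: replicate_Suc)
    then show "w \<in> {xs @ zs | xs zs. xs \<in> star_words k j \<and> zs \<in> range (replicate 1)}"
    proof cases
      case 1
      then obtain zs d where "ys = zs @ [d]" by (metis append_butlast_last_id length_0_conv nat.distinct(1))
      with 1 have "replicate (Suc k) c @ zs \<in> star_words k j" "w = (replicate (Suc k) c @ zs) @ [d]"
        by (auto simp: star_words_def simp del: replicate_Suc)
      then show ?thesis using single by blast
    next
      case 2
      then have "replicate (Suc k) c @ ys \<in> star_words k j" "w = (replicate (Suc k) c @ ys) @ [c]"
        by (auto simp: star_words_def simp del: replicate_Suc)
      then show ?thesis using single by blast
    qed
  qed
  moreover have "star_words k (Suc j) \<inter> ?S = {}"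
    by (auto simp: star_words_def)
  moreover have "?S = rotate1 ` star_words (Suc k) j"
  proof -
    have eq: "replicate (Suc k) c @ ys @ [c] = rotate1 (replicate (Suc (Suc k)) c @ ys)" for c :: nat and ys
      by simp
    have "?S = {rotate1 (replicate (Suc (Suc k)) c @ ys) | c ys. length ys = j \<and> c \<notin> set ys}"
      by (simp only: eq)
    also have "\<dots> = rotate1 ` star_words (Suc k) j"
      unfolding star_words_def by (rule image_setcompr [where f = rotate1
          and h = "\<lambda>c ys. replicate (Suc (Suc k)) c @ ys", symmetric])
    finally show ?thesis .
  qed
  moreover have "word_sf (rotate1 ` star_words (Suc k) j) = word_sf (star_words (Suc k) j)"
    by (rule word_sf_rotate1)
  ultimately have "word_sf {xs @ zs | xs zs. xs \<in> star_words k j \<and> zs \<in> range (replicate 1)} =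
      word_sf (star_words k (Suc j)) + word_sf (star_words (Suc k) j)"
    by (simp add: word_sf_Un)
  moreover have "word_sf {xs @ zs | xs zs. xs \<in> star_words k j \<and> zs \<in> range (replicate 1)} =
      word_sf (star_words k j) * power_sf 0"
    unfolding power_sf_def One_nat_def [symmetric]
    by (rule word_sf_append [where k = "Suc k + j"]) (auto simp: star_words_def)
  ultimately show ?thesis
    by (simp add: algebra_simps)
qed

lemma path_words_0: "word_sf (path_words k 0) = power_sf k"
  by (simp add: power_sf_def path_words_def full_SetCompr_eq del: replicate_Suc)

text \<open>Put a block of \<open>k + 1\<close> equal letters before a proper word: either the word
  begins with another letter, or its first letter merges into the block.\<close>

lemma path_words_Suc:
  "word_sf (path_words k (Suc j)) =
     power_sf k * word_sf {ys. length ys = Suc j \<and> distinct_adj ys} - word_sf (path_words (Suc k) j)"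
proof -
  let ?L = "{xs @ ys | xs ys. xs \<in> range (replicate (Suc k)) \<and> ys \<in> {ys :: nat list. length ys = Suc j \<and> distinct_adj ys}}"
  have "?L = path_words k (Suc j) \<union> path_words (Suc k) j"
  proof (intro Set.set_eqI iffI)
    fix w assume "w \<in> ?L"
    then obtain c d ys where w: "w = replicate (Suc k) c @ d # ys" "length ys = j" "distinct_adj (d # ys)"
      by (auto simp: length_Suc_conv simp del: replicate_Suc)
    show "w \<in> path_words k (Suc j) \<union> path_words (Suc k) j"
    proof (cases "c = d")
      case True
      then have "w = replicate (Suc (Suc k)) d @ ys"
        using w by (simp add: replicate_app_Cons_same)
      then show ?thesis
        unfolding path_words_def using w(2,3)
        by (intro UnI2 CollectI exI [of _ d] exI [of _ ys]) (simp only: simp_thms)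
    next
      case False
      then show ?thesis
        unfolding path_words_def using w
        by (intro UnI1 CollectI exI [of _ c] exI [of _ "d # ys"]) simp
    qed
  next
    fix w assume "w \<in> path_words k (Suc j) \<union> path_words (Suc k) j"
    then consider c ys where "w = replicate (Suc k) c @ ys" "length ys = Suc j" "distinct_adj (c # ys)"
      | c ys where "w = replicate (Suc (Suc k)) c @ ys" "length ys = j" "distinct_adj (c # ys)"
      by (auto simp: path_words_def simp del: replicate_Suc)
    then show "w \<in> ?L"
    proof cases
      case 1
      then show ?thesis by (auto dest: distinct_adj_ConsD simp del: replicate_Suc)
    next
      case 2
      then have "w = replicate (Suc k) c @ c # ys" by (simp add: replicate_app_Cons_same)
      with 2 show ?thesis by (force simp del: replicate_Suc)
    qed
  qed
  moreover have "path_words k (Suc j) \<inter> path_words (Suc k) j = {}"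
  proof -
    \<comment> \<open>After \<open>k\<close> letters are dropped, the rest begins with two different
      letters in one family and with two equal ones in the other.\<close>
    have "w \<notin> path_words (Suc k) j" if w: "w \<in> path_words k (Suc j)" for w
    proof
      assume "w \<in> path_words (Suc k) j"
      then obtain d zs where "w = replicate (Suc (Suc k)) d @ zs"
        by (auto simp: path_words_def simp del: replicate_Suc)
      moreover obtain c ys where "w = replicate (Suc k) c @ ys" "distinct_adj (c # ys)"
        using w unfolding path_words_def by blast
      moreover have "replicate (Suc k) c @ ys = replicate k c @ c # ys"
        by (simp add: replicate_app_Cons_same)
      moreover have "replicate (Suc (Suc k)) d @ zs = replicate k d @ d # d # zs"
        by (simp add: replicate_app_Cons_same)
      ultimately have "replicate k c @ c # ys = replicate k d @ d # d # zs"
        by metis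
      then have "c # ys = d # d # zs"
        by (metis append_eq_append_conv length_replicate)
      with \<open>distinct_adj (c # ys)\<close> show False by simp
    qed
    then show ?thesis by blast
  qed
  ultimately have "word_sf ?L = word_sf (path_words k (Suc j)) + word_sf (path_words (Suc k) j)"
    by (simp add: word_sf_Un)
  moreover have "word_sf ?L = power_sf k * word_sf {ys. length ys = Suc j \<and> distinct_adj ys}"
    unfolding power_sf_def by (rule word_sf_append) auto
  ultimately show ?thesis by (simp only: eq_diff_eq)
qed

lemma proper_words_0: "word_sf {ys. length ys = 0 \<and> distinct_adj ys} = 1"
proof (rule mfps_eqI)
  fix m :: "nat multiset"
  have "{xs :: nat list. (xs = [] \<and> distinct_adj xs) \<and> mset xs = m} = (if m = {#} then {[]} else {})"
    by auto
  then show "mfps_coeff (word_sf {ys. length ys = 0 \<and> distinct_adj ys}) m = mfps_coeff 1 m"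
    by (simp add: word_sf_def one_mfps.rep_eq)
qed

lemma proper_words_Suc:
  "{ys. length ys = Suc n \<and> distinct_adj ys} = path_words 0 n"
  by (auto simp: path_words_def length_Suc_conv)

lemma cycle_words_1: "word_sf (cycle_words k (Suc 0)) = 0"
proof -
  have "cycle_words k (Suc 0) = {}"
    by (auto simp: cycle_words_def length_Suc_conv)
  then show ?thesis by (intro mfps_eqI) (simp add: word_sf_def zero_mfps.rep_eq)
qed

text \<open>A path word closes up to a cycle unless its two ends agree. In that case the last letter
  is moved to the copies of the first; the shortened word closes up, since its new last letter was a
  neighbour of the moved one.\<close>

lemma cycle_words_Suc_Suc:
  "word_sf (cycle_words k (Suc (Suc n))) =
     word_sf (path_words k (Suc n)) - word_sf (cycle_words (Suc k) (Suc n))"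
proof -
  let ?S = "{replicate k (hd ys) @ ys @ [hd ys] | ys. length ys = Suc n \<and> distinct_adj ys \<and> hd ys \<noteq> last ys}"
  have "path_words k (Suc n) = cycle_words k (Suc (Suc n)) \<union> ?S"
  proof (intro Set.set_eqI iffI)
    fix w assume "w \<in> path_words k (Suc n)"
    then obtain c zs d where w: "w = replicate (Suc k) c @ zs @ [d]" "length zs = n" "distinct_adj (c # zs @ [d])"
      by (auto simp: path_words_def simp del: replicate_Suc)
         (metis append_butlast_last_id length_0_conv length_append_singleton nat.distinct(1) nat.inject)
    then have w': "w = replicate k c @ c # zs @ [d]" by (simp add: replicate_app_Cons_same)
    show "w \<in> cycle_words k (Suc (Suc n)) \<union> ?S"
    proof (cases "c = d")
      case True
      have "distinct_adj (c # zs) \<and> c \<noteq> last (c # zs)"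
        using w(3) True distinct_adj_append_iff [of "c # zs" "[d]"] by auto
      then have "w \<in> ?S" using w' w(2) True by (intro CollectI exI [of _ "c # zs"]) simp
      then show ?thesis ..
    next
      case False
      then have "w \<in> cycle_words k (Suc (Suc n))" unfolding cycle_words_def
        using w' w(2,3) by (intro CollectI exI [of _ "c # zs @ [d]"]) simp
      then show ?thesis ..
    qed
  next
    fix w assume "w \<in> cycle_words k (Suc (Suc n)) \<union> ?S"
    then consider ys where "w = replicate k (hd ys) @ ys" "length ys = Suc (Suc n)" "distinct_adj ys"
      | ys where "w = replicate k (hd ys) @ ys @ [hd ys]" "length ys = Suc n" "distinct_adj ys" "hd ys \<noteq> last ys"
      by (auto simp: cycle_words_def)
    then show "w \<in> path_words k (Suc n)"
    proof cases
      case 1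
      then obtain c zs where "ys = c # zs" by (cases ys) auto
      with 1 show ?thesis unfolding path_words_def
        by (intro CollectI exI [of _ c] exI [of _ zs]) (simp add: replicate_app_Cons_same)
    next
      case 2
      then obtain c zs where ys: "ys = c # zs" by (cases ys) auto
      have "distinct_adj (ys @ [c])"
        unfolding distinct_adj_append_iff using 2 ys by auto
      with 2 ys show ?thesis unfolding path_words_def
        by (intro CollectI exI [of _ c] exI [of _ "zs @ [c]"]) (simp add: replicate_app_Cons_same)
    qed
  qed
  moreover have "cycle_words k (Suc (Suc n)) \<inter> ?S = {}"
  proof -
    have False if "replicate k (hd ys) @ ys = replicate k (hd zs) @ zs @ [hd zs]"
      "length ys = Suc (Suc n)" "length zs = Suc n" "hd ys \<noteq> last ys" for ys zs
    proof -
      have "ys = zs @ [hd zs]"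
        using that(1) by (metis append_eq_append_conv length_replicate)
      moreover have "zs \<noteq> []" using that by auto
      ultimately show False using that(4) by simp
    qed
    then show ?thesis unfolding cycle_words_def by blast
  qed
  moreover have "?S = rotate1 ` cycle_words (Suc k) (Suc n)"
  proof -
    have "replicate k (hd ys) @ ys @ [hd ys] = rotate1 (replicate (Suc k) (hd ys) @ ys)" for ys :: "nat list"
      by simp
    then show ?thesis unfolding cycle_words_def by (simp only: image_Collect) blast
  qed
  moreover have "word_sf (rotate1 ` cycle_words (Suc k) (Suc n)) = word_sf (cycle_words (Suc k) (Suc n))"
    by (rule word_sf_rotate1)
  ultimately have "word_sf (path_words k (Suc n)) =
      word_sf (cycle_words k (Suc (Suc n))) + word_sf (cycle_words (Suc k) (Suc n))"
    by (simp add: word_sf_Un)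
  then show ?thesis by simp
qed

section \<open>Stars and pans as families of words\<close>

lemma chromatic_sf_eq_word_sf:
  assumes "fin_simple_graph G" "fst G = {0..<n}"
  shows "chromatic_sf G =
    word_sf {xs. length xs = n \<and> (\<forall>u v. {u, v} \<in> snd G \<longrightarrow> xs ! u \<noteq> xs ! v)}"
proof (rule mfps_eqI)
  fix m
  let ?W = "{xs. length xs = n \<and> (\<forall>u v. {u, v} \<in> snd G \<longrightarrow> xs ! u \<noteq> xs ! v)}"
  have edge: "u < n \<and> v < n" if "{u, v} \<in> snd G" for u v
    using that assms by (auto simp: fin_simple_graph_def)
  have "bij_betw (\<lambda>\<kappa>. map \<kappa> [0..<n])
    {\<kappa> \<in> proper_colourings G. image_mset \<kappa> (mset_set (fst G)) = m} {xs \<in> ?W. mset xs = m}"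
  proof (rule bij_betwI [where g = "\<lambda>xs. restrict ((!) xs) {0..<n}"])
    show "(\<lambda>\<kappa>. map \<kappa> [0..<n]) \<in>
      {\<kappa> \<in> proper_colourings G. image_mset \<kappa> (mset_set (fst G)) = m} \<rightarrow> {xs \<in> ?W. mset xs = m}"
      using edge by (auto simp: proper_colourings_def assms(2))
    show "(\<lambda>xs. restrict ((!) xs) {0..<n}) \<in>
      {xs \<in> ?W. mset xs = m} \<rightarrow> {\<kappa> \<in> proper_colourings G. image_mset \<kappa> (mset_set (fst G)) = m}"
    proof
      fix xs assume xs: "xs \<in> {xs \<in> ?W. mset xs = m}"
      have "image_mset (restrict ((!) xs) {0..<n}) (mset_set {0..<n}) =
          image_mset ((!) xs) (mset_set {0..<n})"
        by (rule image_mset_cong) simp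
      also have "\<dots> = mset (map ((!) xs) [0..<n])" by simp
      also have "map ((!) xs) [0..<n] = xs" using xs map_nth by auto
      also have "mset xs = m" using xs by simp
      finally have "image_mset (restrict ((!) xs) {0..<n}) (mset_set {0..<n}) = m" .
      moreover have "restrict ((!) xs) {0..<n} u \<noteq> restrict ((!) xs) {0..<n} v" if "{u, v} \<in> snd G" for u v
        using xs edge [OF that] that by simp
      ultimately show "restrict ((!) xs) {0..<n} \<in>
          {\<kappa> \<in> proper_colourings G. image_mset \<kappa> (mset_set (fst G)) = m}"
        by (simp add: proper_colourings_def assms(2))
    qed
  qed (auto simp: proper_colourings_def assms(2) PiE_def extensional_def fun_eq_iff intro!: nth_equalityI)
  then show "mfps_coeff (chromatic_sf G) m = mfps_coeff (word_sf ?W) m"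
    by (simp add: chromatic_sf_def word_sf_def bij_betw_same_card)
qed

lemma star_sf_Suc: "star_sf (Suc k) = word_sf (star_words 0 k)"
proof -
  have "{xs. length xs = Suc k \<and> (\<forall>u v. {u, v} \<in> snd (star_graph (Suc k)) \<longrightarrow> xs ! u \<noteq> xs ! v)} =
      star_words 0 k"
  proof -
    have "(\<forall>u v. {u, v} \<in> snd (star_graph (Suc k)) \<longrightarrow> (c # ys) ! u \<noteq> (c # ys) ! v) \<longleftrightarrow> c \<notin> set ys"
      if "length ys = k" for c and ys :: "nat list"
    proof
      assume *: "\<forall>u v. {u, v} \<in> snd (star_graph (Suc k)) \<longrightarrow> (c # ys) ! u \<noteq> (c # ys) ! v"
      have "c \<noteq> ys ! i" if "i < k" for i
      proof -
        have "{0, Suc i} \<in> snd (star_graph (Suc k))"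
          using that by (auto simp: star_graph_def)
        with * have "(c # ys) ! 0 \<noteq> (c # ys) ! Suc i" by blast
        then show ?thesis by simp
      qed
      then show "c \<notin> set ys" using that by (auto simp: in_set_conv_nth)
    next
      assume c: "c \<notin> set ys"
      have "(c # ys) ! u \<noteq> (c # ys) ! v" if "{u, v} \<in> snd (star_graph (Suc k))" for u v
      proof -
        have "\<exists>i. {u, v} = {0, i} \<and> 1 \<le> i \<and> i < Suc k"
          using that by (simp add: star_graph_def)
        then obtain i where "{u, v} = {0, i}" "1 \<le> i" "i < Suc k"
          by metis
        then obtain i where "{u, v} = {0, Suc i}" "i < k"
          by (cases i) auto
        moreover from this(2) have "ys ! i \<in> set ys" using \<open>length ys = k\<close> by simp
        ultimately show ?thesis using c by (auto simp: doubleton_eq_iff)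
      qed
      then show "\<forall>u v. {u, v} \<in> snd (star_graph (Suc k)) \<longrightarrow> (c # ys) ! u \<noteq> (c # ys) ! v"
        by blast
    qed
    then show ?thesis
      by (auto simp: star_words_def length_Suc_conv)
  qed
  then show ?thesis
    unfolding star_sf_def by (subst chromatic_sf_eq_word_sf [OF fin_simple_graph_star])
      (auto simp: star_graph_def)
qed

text \<open>The leaf is a letter appended to a cycle word. A free choice gives the factor
  \<open>power_sf 0\<close>; the forbidden choice, the colour of vertex \<open>0\<close>, rotates to
  the front as an extra copy of the first letter.\<close>

lemma pan_sf_eq:
  assumes "n \<ge> 4"
  shows "chromatic_sf (pan_graph n) =
    power_sf 0 * word_sf (cycle_words 0 (n - 1)) - word_sf (cycle_words 1 (n - 1))"
proof -
  let ?C = "cycle_words 0 (n - 1)"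
  let ?W = "{ys @ [d] | ys d. ys \<in> ?C \<and> d \<noteq> hd ys}"
  have C: "?C = {ys. length ys = n - 1 \<and> distinct_adj ys \<and> hd ys \<noteq> last ys}"
    by (auto simp: cycle_words_def)
  have iff: "(\<forall>u v. {u, v} \<in> snd (pan_graph n) \<longrightarrow> (ys @ [d]) ! u \<noteq> (ys @ [d]) ! v) \<longleftrightarrow>
      ys \<in> ?C \<and> d \<noteq> hd ys" if len: "length ys = n - 1" for ys d
  proof -
    let ?x = "\<lambda>i. (ys @ [d]) ! i"
    have ne: "ys \<noteq> []" using len assms by auto
    have "(\<forall>u v. {u, v} \<in> snd (pan_graph n) \<longrightarrow> ?x u \<noteq> ?x v) \<longleftrightarrow>
        (\<forall>i < n - 1. ?x i \<noteq> ?x ((i + 1) mod (n - 1))) \<and> ?x 0 \<noteq> ?x (n - 1)"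
      by (auto simp: pan_graph_def doubleton_eq_iff)
    also have "(\<forall>i < n - 1. ?x i \<noteq> ?x ((i + 1) mod (n - 1))) \<longleftrightarrow> distinct_adj ys \<and> hd ys \<noteq> last ys"
    proof -
      have "(\<forall>i < n - 1. ?x i \<noteq> ?x ((i + 1) mod (n - 1))) \<longleftrightarrow>
          (\<forall>i < n - 2. ?x i \<noteq> ?x (i + 1)) \<and> ?x (n - 2) \<noteq> ?x 0"
      proof -
        have "n - 2 + 1 = n - 1" using assms by simp
        then have "(n - 2 + 1) mod (n - 1) = 0" by simp
        moreover have "i < n - 1 \<longleftrightarrow> i < n - 2 \<or> i = n - 2" for i using assms by auto
        moreover have "(i + 1) mod (n - 1) = i + 1" if "i < n - 2" for i
          using that by (intro mod_less) simp
        ultimately show ?thesis by (metis (no_types, lifting))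
      qed
      also have "\<dots> \<longleftrightarrow> distinct_adj ys \<and> hd ys \<noteq> last ys"
        using len ne assms by (auto simp: distinct_adj_conv_nth nth_append hd_conv_nth last_conv_nth
            numeral_2_eq_2)
      finally show ?thesis .
    qed
    also have "?x 0 \<noteq> ?x (n - 1) \<longleftrightarrow> d \<noteq> hd ys"
      using len ne by (auto simp: nth_append hd_conv_nth)
    finally show ?thesis unfolding C using len by blast
  qed
  have "{xs. length xs = n \<and> (\<forall>u v. {u, v} \<in> snd (pan_graph n) \<longrightarrow> xs ! u \<noteq> xs ! v)} = ?W"
  proof (intro Set.set_eqI iffI)
    fix xs :: "nat list" assume xs: "xs \<in> {xs. length xs = n \<and> (\<forall>u v. {u, v} \<in> snd (pan_graph n) \<longrightarrow> xs ! u \<noteq> xs ! v)}"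
    moreover obtain ys d where ys: "xs = ys @ [d]"
      using xs assms by (cases xs rule: rev_cases) auto
    ultimately show "xs \<in> ?W" using iff [of ys d] by auto
  next
    fix xs assume "xs \<in> ?W"
    then obtain ys d where ys: "xs = ys @ [d]" "ys \<in> ?C" "d \<noteq> hd ys" by auto
    then have "length ys = n - 1" unfolding C by simp
    with ys iff [of ys d] assms
    show "xs \<in> {xs. length xs = n \<and> (\<forall>u v. {u, v} \<in> snd (pan_graph n) \<longrightarrow> xs ! u \<noteq> xs ! v)}"
      by simp
  qed
  then have pan: "chromatic_sf (pan_graph n) = word_sf ?W"
    by (subst chromatic_sf_eq_word_sf [OF fin_simple_graph_pan [OF assms], of n])
       (simp_all add: pan_graph_def)
  let ?S = "{ys @ [hd ys] | ys. ys \<in> ?C}"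
  have "{ys @ zs | ys zs. ys \<in> ?C \<and> zs \<in> range (replicate 1)} = ?W \<union> ?S" by auto
  moreover have "?W \<inter> ?S = {}" by auto
  moreover have "?S = rotate1 ` cycle_words 1 (n - 1)"
  proof -
    have "ys @ [hd ys] = rotate1 (replicate 1 (hd ys) @ ys)" for ys :: "nat list" by simp
    then show ?thesis unfolding C unfolding cycle_words_def by (simp only: image_Collect) blast
  qed
  moreover have "word_sf (rotate1 ` cycle_words 1 (n - 1)) = word_sf (cycle_words 1 (n - 1))"
    by (rule word_sf_rotate1)
  ultimately have "word_sf {ys @ zs | ys zs. ys \<in> ?C \<and> zs \<in> range (replicate 1)} =
      word_sf ?W + word_sf (cycle_words 1 (n - 1))"
    by (simp add: word_sf_Un)
  moreover have "word_sf {ys @ zs | ys zs. ys \<in> ?C \<and> zs \<in> range (replicate 1)} =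
      word_sf ?C * power_sf 0"
    unfolding power_sf_def One_nat_def [symmetric]
    by (rule word_sf_append [where k = "n - 1"]) (simp add: cycle_words_def)
  ultimately show ?thesis
    by (simp add: pan algebra_simps)
qed

section \<open>Linear independence of the star products\<close>

text \<open>Parts are degrees, whereas \<open>power_sf\<close> is indexed by the number of extra
  copies; hence the shift by one.\<close>

definition power_sf_part :: "nat multiset \<Rightarrow> rat mfps" where
  "power_sf_part \<nu> = (\<Prod>k \<in># \<nu>. power_sf (k - 1))"

lemma coeff_power_sf:
  "mfps_coeff (power_sf k) m = (if \<exists>c. m = replicate_mset (Suc k) c then 1 else 0)"
proof (cases "\<exists>c. m = replicate_mset (Suc k) c")
  case True
  then obtain c where m: "m = replicate_mset (Suc k) c" ..
  have "{xs \<in> range (replicate (Suc k)). mset xs = m} = {replicate (Suc k) c}"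
  proof (intro equalityI subsetI)
    fix xs assume "xs \<in> {xs \<in> range (replicate (Suc k)). mset xs = m}"
    then obtain d where "xs = replicate (Suc k) d" "replicate_mset (Suc k) d = replicate_mset (Suc k) c"
      by (auto simp: m simp del: replicate_Suc replicate_mset_Suc)
    then show "xs \<in> {replicate (Suc k) c}"
      by (auto simp: replicate_mset_eq_iff simp del: replicate_Suc replicate_mset_Suc)
  qed (auto simp: m simp del: replicate_Suc replicate_mset_Suc)
  then show ?thesis using True by (simp add: power_sf_def word_sf_def del: replicate_Suc)
next
  case False
  then have "{xs \<in> range (replicate (Suc k)). mset xs = m} = {}"
    by (auto simp del: replicate_Suc replicate_mset_Suc)
  then show ?thesis using False by (simp add: power_sf_def word_sf_def del: replicate_Suc)
qed

definition exponents :: "nat multiset \<Rightarrow> nat multiset" where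
  "exponents m = image_mset (count m) (mset_set (set_mset m))"

lemma size_exponents: "size (exponents m) = card (set_mset m)"
  by (simp add: exponents_def)

lemma exponents_replicate_plus:
  assumes "c \<notin># m" "k > 0"
  shows "exponents (replicate_mset k c + m) = add_mset k (exponents m)"
proof -
  have "image_mset (count (replicate_mset k c + m)) (mset_set (set_mset m)) =
      image_mset (count m) (mset_set (set_mset m))"
    using assms by (intro image_mset_cong) auto
  moreover have "set_mset (replicate_mset k c + m) = insert c (set_mset m)"
    using assms by (auto simp: set_mset_replicate_mset_subset)
  ultimately show ?thesis
    using assms by (simp add: exponents_def not_in_iff)
qed

text \<open>
  Equal variables can only merge parts of \<open>\<nu>\<close>, so each monomial of \<open>p\<^sub>\<nu>\<close> has at most as many
  variables as \<open>\<nu>\<close> has parts, with equality only for the exponent vector \<open>\<nu>\<close> itself.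
\<close>

lemma coeff_power_sf_part_nonzeroD:
  assumes "mfps_coeff (power_sf_part \<nu>) m \<noteq> 0" "0 \<notin># \<nu>"
  shows "card (set_mset m) \<le> size \<nu> \<and> (card (set_mset m) = size \<nu> \<longrightarrow> exponents m = \<nu>)"
  using assms
proof (induction \<nu> arbitrary: m)
  case empty
  then show ?case by (auto simp: power_sf_part_def one_mfps.rep_eq exponents_def split: if_splits)
next
  case (add k \<nu>)
  then have k: "k > 0" by auto
  have "(\<Sum>(a, b) \<in> {(a, b). a + b = m}.
      mfps_coeff (power_sf (k - 1)) a * mfps_coeff (power_sf_part \<nu>) b) \<noteq> 0"
    using add.prems(1) by (simp add: power_sf_part_def coeff_times_mfps)
  then obtain a b where ab: "a + b = m" "mfps_coeff (power_sf (k - 1)) a \<noteq> 0"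
      "mfps_coeff (power_sf_part \<nu>) b \<noteq> 0"
    by (auto elim!: sum.not_neutral_contains_not_neutral)
  then obtain c where a: "a = replicate_mset k c"
    using k by (auto simp: coeff_power_sf split: if_splits)
  have b: "card (set_mset b) \<le> size \<nu> \<and> (card (set_mset b) = size \<nu> \<longrightarrow> exponents b = \<nu>)"
    using add.prems by (intro add.IH ab) auto
  have m: "set_mset m = insert c (set_mset b)"
    using ab(1) k by (auto simp: a)
  show ?case
  proof (cases "c \<in># b")
    case True
    then show ?thesis using b m by (simp add: insert_absorb)
  next
    case False
    then have "exponents m = add_mset k (exponents b)"
      using ab(1) k a exponents_replicate_plus by blast
    then show ?thesis using b m False by simp
  qed
qed

lemma coeff_power_sf_part_nonneg: "mfps_coeff (power_sf_part \<nu>) m \<ge> 0"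
proof (induction \<nu> arbitrary: m)
  case (add k \<nu>)
  have "power_sf_part (add_mset k \<nu>) = power_sf (k - 1) * power_sf_part \<nu>"
    by (simp add: power_sf_part_def)
  then show ?case
    using add by (auto simp: coeff_times_mfps coeff_power_sf intro!: sum_nonneg mult_nonneg_nonneg)
qed (simp add: power_sf_part_def one_mfps.rep_eq)

text \<open>Each part receives a fresh variable. Since all coefficients are nonnegative, the
  resulting contribution cannot cancel.\<close>

lemma ex_monomial_of_power_sf_part:
  assumes "0 \<notin># \<nu>"
  shows "\<exists>m. exponents m = \<nu> \<and> mfps_coeff (power_sf_part \<nu>) m > 0"
  using assms
proof (induction \<nu>)
  case empty
  then show ?case by (auto simp: power_sf_part_def one_mfps.rep_eq exponents_def)
next
  case (add k \<nu>)
  then obtain m where m: "exponents m = \<nu>" "mfps_coeff (power_sf_part \<nu>) m > 0" by auto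
  obtain c where c: "c \<notin># m" using ex_new_if_finite [of "set_mset m"] by auto
  have k: "k > 0" using add.prems by auto
  let ?m = "replicate_mset k c + m"
  let ?f = "\<lambda>(a, b). mfps_coeff (power_sf (k - 1)) a * mfps_coeff (power_sf_part \<nu>) b"
  have "0 < ?f (replicate_mset k c, m)"
    using m(2) k by (auto simp: coeff_power_sf)
  also have "\<dots> \<le> (\<Sum>p \<in> {(a, b). a + b = ?m}. ?f p)"
    by (rule member_le_sum)
       (auto simp: finite_mset_decomps coeff_power_sf coeff_power_sf_part_nonneg)
  also have "\<dots> = mfps_coeff (power_sf_part (add_mset k \<nu>)) ?m"
    by (simp add: power_sf_part_def coeff_times_mfps)
  finally show ?case
    using exponents_replicate_plus [OF c k] m(1) by blast
qed

interpretation mfps: vector_space "mfps_scale :: rat \<Rightarrow> rat mfps \<Rightarrow> rat mfps"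
  by standard (transfer; simp add: algebra_simps)+

lemma mfps_scale_mult_left: "mfps_scale c f * g = mfps_scale c (f * g)"
  by (rule mfps_eqI) (simp add: coeff_times_mfps mfps_scale.rep_eq sum_distrib_left mult.assoc split_def)

lemma mfps_scale_mult_right: "f * mfps_scale c g = mfps_scale c (f * g)"
  by (metis mfps_scale_mult_left mult.commute)

lemma coeff_sum_mfps: "mfps_coeff (sum f S) m = (\<Sum>i \<in> S. mfps_coeff (f i) m)"
  for f :: "'i \<Rightarrow> 'a::comm_ring_1 mfps"
  by (induction S rule: infinite_finite_induct) (simp_all add: zero_mfps.rep_eq)

text \<open>Among the partitions with nonzero coefficient, let \<open>\<rho>\<close> have the most
  parts. A monomial with exponents \<open>\<rho>\<close> has too many variables for those with fewer
  parts and the wrong exponents for those with equally many, so it isolates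
  \<open>e \<rho>\<close>.\<close>

lemma power_sf_part_independent:
  assumes "finite S" "\<And>\<nu>. \<nu> \<in> S \<Longrightarrow> 0 \<notin># \<nu>"
    and "(\<Sum>\<nu> \<in> S. mfps_scale (e \<nu>) (power_sf_part \<nu>)) = 0" and "\<mu> \<in> S"
  shows "e \<mu> = 0"
proof (rule ccontr)
  assume "e \<mu> \<noteq> 0"
  let ?N = "{\<nu> \<in> S. e \<nu> \<noteq> 0}"
  have "finite ?N" "?N \<noteq> {}" using assms \<open>e \<mu> \<noteq> 0\<close> by auto
  then obtain \<rho> where \<rho>: "\<rho> \<in> ?N" and max: "\<And>\<nu>. \<nu> \<in> ?N \<Longrightarrow> size \<nu> \<le> size \<rho>"
    using Max_in [of "size ` ?N"] Max_ge [of "size ` ?N"] by fastforce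
  obtain m where m: "exponents m = \<rho>" "mfps_coeff (power_sf_part \<rho>) m > 0"
    using ex_monomial_of_power_sf_part \<rho> assms(2) by blast
  have "e \<nu> * mfps_coeff (power_sf_part \<nu>) m = 0" if "\<nu> \<in> S - {\<rho>}" for \<nu>
  proof (rule ccontr)
    assume "e \<nu> * mfps_coeff (power_sf_part \<nu>) m \<noteq> 0"
    then have "e \<nu> \<noteq> 0" "mfps_coeff (power_sf_part \<nu>) m \<noteq> 0" by auto
    then show False
      using coeff_power_sf_part_nonzeroD [of \<nu> m] max [of \<nu>] size_exponents [of m] m(1) that assms(2) by auto
  qed
  then have "(\<Sum>\<nu> \<in> S - {\<rho>}. e \<nu> * mfps_coeff (power_sf_part \<nu>) m) = 0"
    by (intro sum.neutral) blast
  then have "(\<Sum>\<nu> \<in> S. e \<nu> * mfps_coeff (power_sf_part \<nu>) m) = e \<rho> * mfps_coeff (power_sf_part \<rho>) m"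
    using \<rho> assms(1) by (simp add: sum.remove [of S \<rho>])
  moreover have "(\<Sum>\<nu> \<in> S. e \<nu> * mfps_coeff (power_sf_part \<nu>) m) = 0"
    using arg_cong [OF assms(3), of "\<lambda>f. mfps_coeff f m"]
    by (simp add: coeff_sum_mfps mfps_scale.rep_eq zero_mfps.rep_eq)
  ultimately show False using \<rho> m(2) by simp
qed

text \<open>The span is first rewritten with coefficients indexed by \<open>S\<close>; membership
  then becomes a linear relation with coefficient \<open>- 1\<close> at
  \<open>\<mu>\<close>.\<close>

lemma power_sf_part_notin_span:
  assumes "finite S" "\<And>\<nu>. \<nu> \<in> S \<Longrightarrow> 0 \<notin># \<nu>" "\<mu> \<notin> S" "0 \<notin># \<mu>"
  shows "power_sf_part \<mu> \<notin> mfps.span (power_sf_part ` S)"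
proof
  let ?C = "range (\<lambda>e. \<Sum>\<nu> \<in> S. mfps_scale (e \<nu>) (power_sf_part \<nu>))"
  have "mfps.subspace ?C"
  proof (rule mfps.subspaceI)
    show "0 \<in> ?C" by (rule range_eqI [of _ _ "\<lambda>_. 0"]) simp
  next
    fix x y assume "x \<in> ?C" "y \<in> ?C"
    then obtain d e where
      "x = (\<Sum>\<nu> \<in> S. mfps_scale (d \<nu>) (power_sf_part \<nu>))" "y = (\<Sum>\<nu> \<in> S. mfps_scale (e \<nu>) (power_sf_part \<nu>))"
      by blast
    then show "x + y \<in> ?C"
      by (intro range_eqI [of _ _ "\<lambda>\<nu>. d \<nu> + e \<nu>"]) (simp add: mfps.scale_left_distrib sum.distrib)
  next
    fix c x assume "x \<in> ?C"
    then obtain d where "x = (\<Sum>\<nu> \<in> S. mfps_scale (d \<nu>) (power_sf_part \<nu>))" by blast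
    then show "mfps_scale c x \<in> ?C"
      by (intro range_eqI [of _ _ "\<lambda>\<nu>. c * d \<nu>"]) (simp add: mfps.scale_sum_right)
  qed
  moreover have "power_sf_part ` S \<subseteq> ?C"
  proof
    fix x assume "x \<in> power_sf_part ` S"
    then obtain \<nu> where \<nu>: "\<nu> \<in> S" "x = power_sf_part \<nu>" by blast
    have "(\<Sum>\<rho> \<in> S. mfps_scale (if \<rho> = \<nu> then 1 else 0) (power_sf_part \<rho>)) =
        (\<Sum>\<rho> \<in> S. if \<rho> = \<nu> then power_sf_part \<nu> else 0)"
      by (rule sum.cong) auto
    then show "x \<in> ?C"
      using assms(1) \<nu> by (intro range_eqI [of _ _ "\<lambda>\<rho>. if \<rho> = \<nu> then 1 else 0"]) simp
  qed
  ultimately have "mfps.span (power_sf_part ` S) \<subseteq> ?C"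
    by (intro mfps.span_minimal)
  moreover assume "power_sf_part \<mu> \<in> mfps.span (power_sf_part ` S)"
  ultimately obtain e where e: "power_sf_part \<mu> = (\<Sum>\<nu> \<in> S. mfps_scale (e \<nu>) (power_sf_part \<nu>))"
    by blast
  have "(\<Sum>\<nu> \<in> S. mfps_scale ((e(\<mu> := - 1)) \<nu>) (power_sf_part \<nu>)) = power_sf_part \<mu>"
    unfolding e using assms(3) by (intro sum.cong) auto
  then have "(\<Sum>\<nu> \<in> insert \<mu> S. mfps_scale ((e(\<mu> := - 1)) \<nu>) (power_sf_part \<nu>)) = 0"
    using assms(1,3) by (simp add: mfps.scale_minus_left)
  then have "(e(\<mu> := - 1)) \<mu> = 0"
    using assms by (intro power_sf_part_independent [of "insert \<mu> S" "e(\<mu> := - 1)" \<mu>]) auto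
  then show False by simp
qed

section \<open>Filtration by the number of parts, and triangularity of the star products\<close>

definition power_span :: "nat \<Rightarrow> nat \<Rightarrow> rat mfps set" where
  "power_span n l = mfps.span (power_sf_part ` {\<nu> \<in> partitions n. size \<nu> \<ge> l})"

text \<open>By bilinearity it suffices to multiply two power sum products, which joins their
  partitions and adds both degrees and numbers of parts.\<close>

lemma power_span_mult:
  assumes "f \<in> power_span n l" "h \<in> power_span n' l'"
  shows "f * h \<in> power_span (n + n') (l + l')"
proof -
  have "power_sf_part \<nu> * h \<in> power_span (n + n') (l + l')" if \<nu>: "\<nu> \<in> partitions n" "size \<nu> \<ge> l" for \<nu>
    using assms(2) unfolding power_span_def
  proof (induction h rule: mfps.span_induct_alt)
    case (step c x y)
    then obtain \<nu>' where \<nu>': "\<nu>' \<in> partitions n'" "size \<nu>' \<ge> l'" "x = power_sf_part \<nu>'" by blast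
    have "power_sf_part \<nu> * x = power_sf_part (\<nu> + \<nu>')"
      by (simp add: \<nu>'(3) power_sf_part_def)
    moreover have "\<nu> + \<nu>' \<in> {\<nu> \<in> partitions (n + n'). size \<nu> \<ge> l + l'}"
      using \<nu> \<nu>' by (auto simp: partitions_def)
    then have "power_sf_part (\<nu> + \<nu>') \<in> mfps.span (power_sf_part ` {\<nu> \<in> partitions (n + n'). size \<nu> \<ge> l + l'})"
      by (intro mfps.span_base imageI)
    ultimately have "power_sf_part \<nu> * x \<in> mfps.span (power_sf_part ` {\<nu> \<in> partitions (n + n'). size \<nu> \<ge> l + l'})"
      by simp
    then show ?case
      using step by (simp add: distrib_left mfps_scale_mult_right mfps.span_add mfps.span_scale)
  qed (simp add: mfps.span_zero)
  note * = this
  show ?thesis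
    using assms(1) unfolding power_span_def
  proof (induction f rule: mfps.span_induct_alt)
    case (step c x y)
    then have "x * h \<in> power_span (n + n') (l + l')" using * by blast
    then show ?case
      using step unfolding power_span_def by (auto simp: distrib_right mfps_scale_mult_left
          intro!: mfps.span_add mfps.span_scale)
  qed (simp add: mfps.span_zero)
qed

lemma power_span_mono: "l' \<le> l \<Longrightarrow> f \<in> power_span n l \<Longrightarrow> f \<in> power_span n l'"
  unfolding power_span_def using mfps.span_mono [of "power_sf_part ` {\<nu> \<in> partitions n. size \<nu> \<ge> l}"
    "power_sf_part ` {\<nu> \<in> partitions n. size \<nu> \<ge> l'}"] by fastforce

lemma power_sf_part_in_span: "\<nu> \<in> partitions n \<Longrightarrow> power_sf_part \<nu> \<in> power_span n (size \<nu>)"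
  by (auto simp: power_span_def intro: mfps.span_base)

lemma power_sf_in_span: "power_sf k \<in> power_span (Suc k) 1"
  using power_sf_part_in_span [of "{#Suc k#}"] by (simp add: power_sf_part_def partitions_def)

text \<open>In the star recurrence the product with \<open>power_sf 0\<close> has at least two
  parts, so modulo these only the term with one more copy remains, with opposite sign. Thus
  \<open>\<epsilon>\<close> is \<open>(- 1) ^ j\<close>.\<close>

lemma star_words_triangular:
  "\<exists>\<epsilon>. \<epsilon> \<noteq> 0 \<and> word_sf (star_words k j) - mfps_scale \<epsilon> (power_sf (k + j)) \<in> power_span (Suc (k + j)) 2"
proof (induction j arbitrary: k)
  case 0
  show ?case by (rule exI [of _ 1]) (simp add: star_words_0 power_span_def mfps.span_zero)
next
  case (Suc j)
  obtain \<epsilon> where \<epsilon>: "word_sf (star_words k j) - mfps_scale \<epsilon> (power_sf (k + j)) \<in> power_span (Suc (k + j)) 2"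
    using Suc by blast
  obtain \<delta> where \<delta>: "\<delta> \<noteq> 0"
    "word_sf (star_words (Suc k) j) - mfps_scale \<delta> (power_sf (Suc k + j)) \<in> power_span (Suc (Suc k + j)) 2"
    using Suc by blast
  have "power_sf 0 * (word_sf (star_words k j) - mfps_scale \<epsilon> (power_sf (k + j))) \<in> power_span (Suc (Suc k + j)) 2"
    using power_span_mono [OF _ power_span_mult [OF power_sf_in_span [of 0] \<epsilon>], of 2] by simp
  moreover have "mfps_scale \<epsilon> (power_sf 0 * power_sf (k + j)) \<in> power_span (Suc (Suc k + j)) 2"
    using power_span_mult [OF power_sf_in_span [of 0] power_sf_in_span [of "k + j"]]
    by (simp add: power_span_def mfps.span_scale numeral_2_eq_2)
  ultimately have "power_sf 0 * (word_sf (star_words k j) - mfps_scale \<epsilon> (power_sf (k + j)))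
      + mfps_scale \<epsilon> (power_sf 0 * power_sf (k + j))
      - (word_sf (star_words (Suc k) j) - mfps_scale \<delta> (power_sf (Suc k + j))) \<in> power_span (Suc (Suc k + j)) 2"
    using \<delta>(2) unfolding power_span_def by (rule mfps.span_diff [OF mfps.span_add])
  then show ?case
    using \<delta>(1) by (intro exI [of _ "- \<delta>"])
      (simp add: star_words_Suc mfps_scale_mult_right algebra_simps mfps.scale_minus_left)
qed

text \<open>Both factors are split into leading term and remainder. Exchanging a leading term for
  its remainder costs at least one additional part, so only the product of the leading terms has
  \<open>size \<mu>\<close> parts.\<close>

lemma star_sf_part_triangular:
  assumes "\<mu> \<in> partitions n"
  shows "\<exists>\<epsilon>. \<epsilon> \<noteq> 0 \<and> star_sf_part \<mu> - mfps_scale \<epsilon> (power_sf_part \<mu>) \<in> power_span n (Suc (size \<mu>))"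
  using assms
proof (induction \<mu> arbitrary: n)
  case empty
  show ?case
    by (rule exI [of _ 1]) (simp add: star_sf_part_def power_sf_part_def power_span_def mfps.span_zero)
next
  case (add k \<mu>)
  define n' where "n' = \<Sum>\<^sub># \<mu>"
  have k: "k > 0" and n: "n = k + n'" and \<mu>: "\<mu> \<in> partitions n'"
    using add.prems by (auto simp: partitions_def n'_def)
  obtain \<epsilon> where \<epsilon>: "\<epsilon> \<noteq> 0" "star_sf k - mfps_scale \<epsilon> (power_sf (k - 1)) \<in> power_span k 2"
    using star_words_triangular [of 0 "k - 1"] k by (auto simp: star_sf_Suc [symmetric])
  obtain \<delta> where \<delta>: "\<delta> \<noteq> 0"
    "star_sf_part \<mu> - mfps_scale \<delta> (power_sf_part \<mu>) \<in> power_span n' (Suc (size \<mu>))"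
    using add.IH [OF \<mu>] by blast
  let ?x = "star_sf k - mfps_scale \<epsilon> (power_sf (k - 1))"
  let ?y = "star_sf_part \<mu> - mfps_scale \<delta> (power_sf_part \<mu>)"
  have p: "power_sf (k - 1) \<in> power_span k 1" using power_sf_in_span [of "k - 1"] k by simp
  have "?x * ?y \<in> power_span n (Suc (Suc (size \<mu>)))"
    using power_span_mono [OF _ power_span_mult [OF \<epsilon>(2) \<delta>(2)]] n by simp
  moreover have "mfps_scale \<epsilon> (power_sf (k - 1) * ?y) \<in> power_span n (Suc (Suc (size \<mu>)))"
    using power_span_mult [OF p \<delta>(2)] n by (simp add: power_span_def mfps.span_scale)
  moreover have "mfps_scale \<delta> (?x * power_sf_part \<mu>) \<in> power_span n (Suc (Suc (size \<mu>)))"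
    using power_span_mult [OF \<epsilon>(2) power_sf_part_in_span [OF \<mu>]] n
    by (simp add: power_span_def mfps.span_scale)
  ultimately have "?x * ?y + mfps_scale \<epsilon> (power_sf (k - 1) * ?y) + mfps_scale \<delta> (?x * power_sf_part \<mu>)
      \<in> power_span n (Suc (Suc (size \<mu>)))"
    unfolding power_span_def by (intro mfps.span_add)
  moreover have "?x * ?y + mfps_scale \<epsilon> (power_sf (k - 1) * ?y) + mfps_scale \<delta> (?x * power_sf_part \<mu>) =
      star_sf_part (add_mset k \<mu>) - mfps_scale (\<epsilon> * \<delta>) (power_sf_part (add_mset k \<mu>))"
    by (simp add: star_sf_part_def power_sf_part_def left_diff_distrib right_diff_distrib
        mfps_scale_mult_left mfps_scale_mult_right mfps.scale_right_diff_distrib mult.commute)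
  ultimately show ?case
    using \<epsilon>(1) \<delta>(1) by (intro exI [of _ "\<epsilon> * \<delta>"]) simp
qed

text \<open>Now \<open>\<kappa>\<close> has the fewest parts among the nonzero coefficients. Every
  remainder has more parts than \<open>\<kappa>\<close> and the other leading terms belong to other
  partitions, so the relation would express \<open>power_sf_part \<kappa>\<close> through the
  rest.\<close>

lemma star_sf_part_independent:
  assumes "(\<Sum>\<mu> \<in> partitions n. mfps_scale (d \<mu>) (star_sf_part \<mu>)) = 0" and "\<rho> \<in> partitions n"
  shows "d \<rho> = 0"
proof (rule ccontr)
  assume "d \<rho> \<noteq> 0"
  let ?N = "{\<mu> \<in> partitions n. d \<mu> \<noteq> 0}"
  have "finite ?N" "?N \<noteq> {}" using assms \<open>d \<rho> \<noteq> 0\<close> finite_partitions by auto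
  then obtain \<kappa> where \<kappa>: "\<kappa> \<in> ?N" and min: "\<And>\<mu>. \<mu> \<in> ?N \<Longrightarrow> size \<kappa> \<le> size \<mu>"
    using Min_in [of "size ` ?N"] Min_le [of "size ` ?N"] by fastforce
  let ?D = "mfps.span (power_sf_part ` (partitions n - {\<kappa>}))"
  have sub: "f \<in> ?D" if "f \<in> power_span n l" "l > size \<kappa>" for f l
    using that mfps.span_mono [of "power_sf_part ` {\<nu> \<in> partitions n. size \<nu> \<ge> l}"
        "power_sf_part ` (partitions n - {\<kappa>})"] unfolding power_span_def by fastforce
  have rest: "mfps_scale (d \<mu>) (star_sf_part \<mu>) \<in> ?D" if \<mu>: "\<mu> \<in> partitions n - {\<kappa>}" for \<mu>
  proof (cases "d \<mu> = 0")
    case False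
    obtain \<epsilon> where "star_sf_part \<mu> - mfps_scale \<epsilon> (power_sf_part \<mu>) \<in> power_span n (Suc (size \<mu>))"
      using star_sf_part_triangular \<mu> by blast
    then have "star_sf_part \<mu> - mfps_scale \<epsilon> (power_sf_part \<mu>) \<in> ?D"
      using min [of \<mu>] \<mu> False by (intro sub) auto
    moreover have "mfps_scale \<epsilon> (power_sf_part \<mu>) \<in> ?D"
      using \<mu> by (intro mfps.span_scale mfps.span_base) blast
    ultimately have "star_sf_part \<mu> - mfps_scale \<epsilon> (power_sf_part \<mu>) + mfps_scale \<epsilon> (power_sf_part \<mu>) \<in> ?D"
      by (rule mfps.span_add)
    then show ?thesis by (intro mfps.span_scale) simp
  qed (simp add: mfps.span_zero)
  obtain \<epsilon> where \<epsilon>: "\<epsilon> \<noteq> 0"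
    "star_sf_part \<kappa> - mfps_scale \<epsilon> (power_sf_part \<kappa>) \<in> power_span n (Suc (size \<kappa>))"
    using star_sf_part_triangular \<kappa> by blast
  let ?x = "star_sf_part \<kappa> - mfps_scale \<epsilon> (power_sf_part \<kappa>)"
  let ?r = "\<Sum>\<mu> \<in> partitions n - {\<kappa>}. mfps_scale (d \<mu>) (star_sf_part \<mu>)"
  have "mfps_scale (d \<kappa>) (star_sf_part \<kappa>) + ?r = 0"
    using assms(1) \<kappa> finite_partitions by (simp add: sum.remove [of "partitions n" \<kappa>])
  then have "mfps_scale (d \<kappa> * \<epsilon>) (power_sf_part \<kappa>) = - ?r - mfps_scale (d \<kappa>) ?x"
    by (simp add: mfps.scale_right_diff_distrib algebra_simps eq_neg_iff_add_eq_0)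
  moreover have "?r \<in> ?D"
    using rest by (rule mfps.span_sum)
  moreover have "?x \<in> ?D"
    by (rule sub [OF \<epsilon>(2)]) simp
  then have "- ?r - mfps_scale (d \<kappa>) ?x \<in> ?D"
    by (rule mfps.span_diff [OF mfps.span_neg [OF \<open>?r \<in> ?D\<close>] mfps.span_scale])
  ultimately have "mfps_scale (d \<kappa> * \<epsilon>) (power_sf_part \<kappa>) \<in> ?D" by simp
  then have "mfps_scale (inverse (d \<kappa> * \<epsilon>)) (mfps_scale (d \<kappa> * \<epsilon>) (power_sf_part \<kappa>)) \<in> ?D"
    by (rule mfps.span_scale)
  moreover have "inverse (d \<kappa> * \<epsilon>) * (d \<kappa> * \<epsilon>) = 1"
    using \<kappa> \<epsilon>(1) by (intro left_inverse) simp
  ultimately have "power_sf_part \<kappa> \<in> ?D"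
    by (simp only: mfps.scale_scale mfps.scale_one)
  moreover have "power_sf_part \<kappa> \<notin> ?D"
    using \<kappa> finite_partitions by (intro power_sf_part_notin_span) (auto simp: partitions_def)
  ultimately show False by contradiction
qed

section \<open>The star expansion of the pan graph\<close>

lemma mset_natpermute: "mset ` natpermute N j = {\<nu>. size \<nu> = j \<and> \<Sum>\<^sub># \<nu> = N}"
proof (intro equalityI subsetI)
  fix \<nu> assume "\<nu> \<in> {\<nu>. size \<nu> = j \<and> \<Sum>\<^sub># \<nu> = N}"
  moreover obtain v where "\<nu> = mset v" using ex_mset by metis
  ultimately show "\<nu> \<in> mset ` natpermute N j"
    by (auto simp: natpermute_def sum_mset_sum_list)
qed (auto simp: natpermute_def sum_mset_sum_list)

text \<open>The power expands over compositions of \<open>N\<close> into \<open>j\<close> parts,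
  zeros allowed; a multiset collects one composition for each of its arrangements.\<close>

lemma fps_power_nth_multiset:
  "(a ^ j) $ N = (\<Sum>\<nu> \<in> {\<nu>. size \<nu> = j \<and> \<Sum>\<^sub># \<nu> = N}.
     of_nat (card (permutations_of_multiset \<nu>)) * (\<Prod>k \<in># \<nu>. a $ k))"
  for a :: "'a::comm_ring_1 fps"
proof -
  have "(a ^ j) $ N = (\<Sum>v \<in> natpermute N j. prod_list (map (fps_nth a) v))"
  proof (cases j)
    case (Suc i)
    have "(\<Prod>k = 0..i. a $ (v ! k)) = prod_list (map (fps_nth a) v)" if "v \<in> natpermute N j" for v
      using that by (simp add: natpermute_def Suc prod.list_conv_set_nth atLeastLessThanSuc_atLeastAtMost)
    then show ?thesis
      by (simp add: fps_power_nth_Suc Suc del: power_Suc)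
  qed (simp add: natpermute_0)
  also have "\<dots> = (\<Sum>\<nu> \<in> mset ` natpermute N j. \<Sum>v \<in> {v \<in> natpermute N j. mset v = \<nu>}.
      prod_list (map (fps_nth a) v))"
    by (rule sum.image_gen) (rule natpermute_finite)
  also note mset_natpermute
  also have "(\<Sum>\<nu> \<in> {\<nu>. size \<nu> = j \<and> \<Sum>\<^sub># \<nu> = N}. \<Sum>v \<in> {v \<in> natpermute N j. mset v = \<nu>}.
        prod_list (map (fps_nth a) v)) =
      (\<Sum>\<nu> \<in> {\<nu>. size \<nu> = j \<and> \<Sum>\<^sub># \<nu> = N}.
        of_nat (card (permutations_of_multiset \<nu>)) * (\<Prod>k \<in># \<nu>. a $ k))"
  proof (rule sum.cong [OF refl])
    fix \<nu> :: "nat multiset" assume \<nu>: "\<nu> \<in> {\<nu>. size \<nu> = j \<and> \<Sum>\<^sub># \<nu> = N}"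
    have "{v \<in> natpermute N j. mset v = \<nu>} = permutations_of_multiset \<nu>"
      using \<nu> by (auto simp: natpermute_def permutations_of_multiset_def sum_mset_sum_list [symmetric])
    moreover have "prod_list (map (fps_nth a) v) = (\<Prod>k \<in># \<nu>. a $ k)"
      if "v \<in> permutations_of_multiset \<nu>" for v
      using that by (auto simp: permutations_of_multiset_def prod_mset_prod_list [symmetric])
    ultimately show "(\<Sum>v \<in> {v \<in> natpermute N j. mset v = \<nu>}. prod_list (map (fps_nth a) v)) =
        of_nat (card (permutations_of_multiset \<nu>)) * (\<Prod>k \<in># \<nu>. a $ k)"
      by simp
  qed
  finally show ?thesis .
qed

interpretation words: pan_recurrences power_sf
  "\<lambda>k j. word_sf (star_words k j)" "\<lambda>k j. word_sf (path_words k j)"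
  "\<lambda>k n. word_sf (cycle_words k n)" "\<lambda>n. word_sf {ys. length ys = n \<and> distinct_adj ys}"
  by standard (simp_all only: star_words_0 star_words_Suc path_words_0 path_words_Suc
      proper_words_0 proper_words_Suc cycle_words_1 cycle_words_Suc_Suc)

lemma T_nth: "words.T $ k = (if k < 2 then 0 else star_sf k)"
  by (simp add: words.T_def star_sf_Suc [symmetric])

definition big_partitions :: "nat \<Rightarrow> nat \<Rightarrow> nat multiset set" where
  "big_partitions j N = {\<nu>. (\<forall>k \<in># \<nu>. k \<ge> 2) \<and> size \<nu> = j \<and> \<Sum>\<^sub># \<nu> = N}"

lemma finite_big_partitions: "finite (big_partitions j N)"
  by (rule finite_subset [OF _ finite_partitions [of N]]) (auto simp: big_partitions_def partitions_def)

lemma T_power_nth: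
  "(words.T ^ j) $ N = (\<Sum>\<nu> \<in> big_partitions j N.
     of_nat (card (permutations_of_multiset \<nu>)) * star_sf_part \<nu>)"
proof -
  have finite: "finite {\<nu> :: nat multiset. size \<nu> = j \<and> \<Sum>\<^sub># \<nu> = N}"
    by (metis mset_natpermute finite_imageI natpermute_finite)
  have big: "(\<Prod>k \<in># \<nu>. words.T $ k) = star_sf_part \<nu>" if "\<forall>k \<in># \<nu>. k \<ge> 2" for \<nu>
    unfolding star_sf_part_def using that
    by (intro arg_cong [where f = prod_mset] image_mset_cong) (auto simp: T_nth)
  have small: "(\<Prod>k \<in># \<nu>. words.T $ k) = 0" if not_big: "\<not> (\<forall>k \<in># \<nu>. k \<ge> 2)" for \<nu>
  proof -
    obtain k where "k \<in># \<nu>" "k < 2" using not_big by auto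
    moreover from this(1) obtain \<nu>' where "\<nu> = add_mset k \<nu>'" by (metis mset_add)
    ultimately show ?thesis by (simp add: T_nth)
  qed
  show ?thesis
    unfolding fps_power_nth_multiset
  proof (rule sum.mono_neutral_cong_right [OF finite])
    show "\<forall>\<nu> \<in> {\<nu>. size \<nu> = j \<and> \<Sum>\<^sub># \<nu> = N} - big_partitions j N.
      of_nat (card (permutations_of_multiset \<nu>)) * (\<Prod>k \<in># \<nu>. words.T $ k) = 0"
    proof
      fix \<nu> assume "\<nu> \<in> {\<nu>. size \<nu> = j \<and> \<Sum>\<^sub># \<nu> = N} - big_partitions j N"
      then have "\<not> (\<forall>k \<in># \<nu>. k \<ge> 2)" by (auto simp: big_partitions_def)
      then have "(\<Prod>k \<in># \<nu>. words.T $ k) = 0" by (rule small)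
      then show "of_nat (card (permutations_of_multiset \<nu>)) * (\<Prod>k \<in># \<nu>. words.T $ k) = 0"
        by (simp only: mult_zero_right)
    qed
  qed (auto simp: big_partitions_def big)
qed

text \<open>For \<open>\<nu>\<close> with \<open>j\<close> parts, all above one, of sum
  \<open>N\<close>, this is the coefficient of its star product times \<open>n - N\<close>
  one-vertex stars: arrangements come from \<open>T ^ j\<close>, the sign from the powers of
  \<open>- s\<close>, and the \<open>j = 1\<close> correction from the trailing
  \<open>- V\<close>.\<close>

definition star_coeff :: "nat \<Rightarrow> nat \<Rightarrow> nat \<Rightarrow> nat multiset \<Rightarrow> rat" where
  "star_coeff n j N \<nu> = of_nat (card (permutations_of_multiset \<nu>)) * (- 1) ^ (n - N) *
     ((of_nat N - of_nat j) / of_nat j * of_nat ((N - j + (n - N) - 1) choose (n - N)) -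
      (if j = 1 then of_nat ((N - 1 + (n - N) - 1) choose (n - N)) else 0))"

lemma of_nat_mfps: "(of_nat k :: rat mfps) = mfps_scale (of_nat k) 1"
  by (induction k) (simp_all add: mfps.scale_left_distrib)

lemma minus_power_mfps: "(- f) ^ k = mfps_scale ((- 1) ^ k) (f ^ k)" for f :: "rat mfps"
  by (induction k) (simp_all add: mfps_scale_mult_left mfps_scale_mult_right)

lemma pan_sf_expansion:
  assumes "n \<ge> 4"
  shows "chromatic_sf (pan_graph n) = (\<Sum>j = 1..n. \<Sum>N = 0..n. \<Sum>\<nu> \<in> big_partitions j N.
    mfps_scale (star_coeff n j N \<nu>) (star_sf_part (\<nu> + replicate_mset (n - N) 1)))"
proof -
  let ?s = "power_sf 0"
  let ?b = "\<lambda>j N. (N - j + (n - N) - 1) choose (n - N)"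
  obtain t where t: "\<And>n. n \<ge> 2 \<Longrightarrow>
      ?s * word_sf (cycle_words 0 (n - 1)) - word_sf (cycle_words 1 (n - 1)) = (\<Sum>j = 1..n. t j n) -
      (\<Sum>N = 0..n. words.T $ N * ((- ?s) ^ (n - N) * of_nat ((N - 1 + (n - N) - 1) choose (n - N))))"
    and jt: "\<And>j n. of_nat j * t j n = (\<Sum>N = 0..n. (of_nat N - of_nat j) * (words.T ^ j) $ N *
      ((- ?s) ^ (n - N) * of_nat ((N - j + (n - N) - 1) choose (n - N))))"
    by (rule words.pan_coefficient) blast
  \<comment> \<open>The trailing \<open>- V\<close> is linear in \<open>T\<close>, so it is filed
    under \<open>j = 1\<close>.\<close>
  let ?g = "\<lambda>j. t j n - (if j = 1 then \<Sum>N = 0..n. (words.T ^ j) $ N * ((- ?s) ^ (n - N) * of_nat (?b j N)) else 0)"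
  have "chromatic_sf (pan_graph n) = (\<Sum>j = 1..n. ?g j)"
    using assms t [of n] by (simp add: pan_sf_eq sum_subtractf sum.delta)
  also have "\<dots> = (\<Sum>j = 1..n. \<Sum>N = 0..n. \<Sum>\<nu> \<in> big_partitions j N.
    mfps_scale (star_coeff n j N \<nu>) (star_sf_part (\<nu> + replicate_mset (n - N) 1)))"
  proof (rule sum.cong [OF refl])
    fix j assume j: "j \<in> {1..n}"
    have s: "star_sf_part (\<nu> + replicate_mset a 1) = star_sf_part \<nu> * ?s ^ a" for \<nu> a
      by (simp add: star_sf_part_def star_sf_Suc star_words_0)
    \<comment> \<open>The postponed division by \<open>j\<close> takes place here, by rational
      scalars.\<close>
    have "t j n = mfps_scale (1 / of_nat j) (of_nat j * t j n)"
      using j by (simp add: of_nat_mfps mfps_scale_mult_left)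
    also have "\<dots> = (\<Sum>N = 0..n. mfps_scale ((of_nat N - of_nat j) / of_nat j)
        ((words.T ^ j) $ N * ((- ?s) ^ (n - N) * of_nat (?b j N))))"
      unfolding jt mfps.scale_sum_right
      by (intro sum.cong refl) (simp add: of_nat_mfps mfps.scale_left_diff_distrib [symmetric]
          mfps_scale_mult_left mult.assoc)
    finally have "?g j = (\<Sum>N = 0..n. mfps_scale ((of_nat N - of_nat j) / of_nat j - (if j = 1 then 1 else 0))
        ((words.T ^ j) $ N * ((- ?s) ^ (n - N) * of_nat (?b j N))))"
      by (auto simp: mfps.scale_left_diff_distrib sum_subtractf)
    also have "\<dots> = (\<Sum>N = 0..n. \<Sum>\<nu> \<in> big_partitions j N.
      mfps_scale (star_coeff n j N \<nu>) (star_sf_part (\<nu> + replicate_mset (n - N) 1)))"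
    proof (rule sum.cong [OF refl])
      fix N
      have "mfps_scale ((of_nat N - of_nat j) / of_nat j - (if j = 1 then 1 else 0))
          (of_nat (card (permutations_of_multiset \<nu>)) * star_sf_part \<nu> * ((- ?s) ^ (n - N) * of_nat (?b j N))) =
          mfps_scale (star_coeff n j N \<nu>) (star_sf_part (\<nu> + replicate_mset (n - N) 1))" for \<nu>
        unfolding s of_nat_mfps minus_power_mfps
        by (auto simp: mfps_scale_mult_left mfps_scale_mult_right star_coeff_def
            algebra_simps intro!: arg_cong2 [where f = mfps_scale])
      then show "mfps_scale ((of_nat N - of_nat j) / of_nat j - (if j = 1 then 1 else 0))
          ((words.T ^ j) $ N * ((- ?s) ^ (n - N) * of_nat (?b j N))) =
        (\<Sum>\<nu> \<in> big_partitions j N.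
          mfps_scale (star_coeff n j N \<nu>) (star_sf_part (\<nu> + replicate_mset (n - N) 1)))"
        by (simp only: T_power_nth sum_distrib_right mfps.scale_sum_right)
    qed
    finally show "?g j = (\<Sum>N = 0..n. \<Sum>\<nu> \<in> big_partitions j N.
      mfps_scale (star_coeff n j N \<nu>) (star_sf_part (\<nu> + replicate_mset (n - N) 1)))" .
  qed
  finally show ?thesis .
qed

section \<open>Parts above one, and the closed form of the coefficients\<close>

abbreviation big_parts :: "nat multiset \<Rightarrow> nat multiset" where
  "big_parts \<mu> \<equiv> filter_mset (\<lambda>k. 2 \<le> k) \<mu>"

lemma big_parts_plus_ones:
  assumes "0 \<notin># \<mu>"
  shows "\<mu> = big_parts \<mu> + replicate_mset (count \<mu> 1) 1"
proof (rule multiset_eqI)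
  fix k :: nat
  consider "k = 0" | "k = 1" | "k \<ge> 2" by linarith
  then show "count \<mu> k = count (big_parts \<mu> + replicate_mset (count \<mu> 1) 1) k"
    using assms by cases (auto simp: not_in_iff)
qed

lemma partition_big_parts:
  assumes "\<mu> \<in> partitions n"
  shows "\<Sum>\<^sub># (big_parts \<mu>) + count \<mu> 1 = n" "size (big_parts \<mu>) + count \<mu> 1 = size \<mu>"
    "2 * size (big_parts \<mu>) \<le> \<Sum>\<^sub># (big_parts \<mu>)"
proof -
  have \<mu>: "\<mu> = big_parts \<mu> + replicate_mset (count \<mu> 1) 1"
    using assms by (intro big_parts_plus_ones) (simp add: partitions_def)
  have "\<Sum>\<^sub># \<mu> = \<Sum>\<^sub># (big_parts \<mu>) + count \<mu> 1"
    by (subst \<mu>) (simp del: filter_mset_add_mset)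
  then show "\<Sum>\<^sub># (big_parts \<mu>) + count \<mu> 1 = n"
    using assms by (simp add: partitions_def)
  have "size \<mu> = size (big_parts \<mu>) + count \<mu> 1"
    by (subst \<mu>) simp
  then show "size (big_parts \<mu>) + count \<mu> 1 = size \<mu>" ..
  have "2 * size \<nu> \<le> \<Sum>\<^sub># \<nu>" if "\<forall>k \<in># \<nu>. 2 \<le> k" for \<nu> :: "nat multiset"
    using that by (induction \<nu>) auto
  then show "2 * size (big_parts \<mu>) \<le> \<Sum>\<^sub># (big_parts \<mu>)" by simp
qed

text \<open>The sum over \<open>j\<close> starts at \<open>1\<close>, so the partition into ones
  never occurs and receives \<open>0\<close>.\<close>

definition pan_coeff :: "nat \<Rightarrow> nat multiset \<Rightarrow> rat" where
  "pan_coeff n \<mu> = (if big_parts \<mu> = {#} then 0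
     else star_coeff n (size (big_parts \<mu>)) (\<Sum>\<^sub># (big_parts \<mu>)) (big_parts \<mu>))"

text \<open>A partition of \<open>n\<close> is determined by its parts above one, the remainder
  being filled with ones; these parts also fix \<open>j\<close> and \<open>N\<close>.\<close>

lemma pan_sf_star_expansion:
  assumes "n \<ge> 4"
  shows "chromatic_sf (pan_graph n) = (\<Sum>\<mu> \<in> partitions n. mfps_scale (pan_coeff n \<mu>) (star_sf_part \<mu>))"
proof -
  let ?P = "{\<mu> \<in> partitions n. big_parts \<mu> \<noteq> {#}}"
  let ?I = "SIGMA j : {1..n}. SIGMA N : {0..n}. big_partitions j N"
  have "chromatic_sf (pan_graph n) = (\<Sum>(j, N, \<nu>) \<in> ?I.
      mfps_scale (star_coeff n j N \<nu>) (star_sf_part (\<nu> + replicate_mset (n - N) 1)))"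
    using assms by (simp add: pan_sf_expansion sum.Sigma finite_big_partitions)
  also have "\<dots> = (\<Sum>\<mu> \<in> ?P. mfps_scale (pan_coeff n \<mu>) (star_sf_part \<mu>))"
  proof (rule sum.reindex_bij_witness
      [where i = "\<lambda>\<mu>. (size (big_parts \<mu>), \<Sum>\<^sub># (big_parts \<mu>), big_parts \<mu>)"
        and j = "\<lambda>(j, N, \<nu>). \<nu> + replicate_mset (n - N) 1"])
    fix x assume "x \<in> ?I"
    then obtain j N \<nu> where x: "x = (j, N, \<nu>)" "j \<ge> 1" "N \<le> n" "\<forall>k \<in># \<nu>. 2 \<le> k" "size \<nu> = j" "\<Sum>\<^sub># \<nu> = N"
      by (auto simp: big_partitions_def)
    have "big_parts \<nu> = \<nu>" using x(4) by (simp add: filter_mset_eq_conv)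
    moreover have "big_parts (replicate_mset (n - N) 1) = {#}" by (simp add: filter_mset_eq_conv)
    ultimately have b: "big_parts (\<nu> + replicate_mset (n - N) 1) = \<nu>" "\<nu> \<noteq> {#}"
      using x by auto
    show "(\<lambda>\<mu>. (size (big_parts \<mu>), \<Sum>\<^sub># (big_parts \<mu>), big_parts \<mu>))
        (case x of (j, N, \<nu>) \<Rightarrow> \<nu> + replicate_mset (n - N) 1) = x"
      using x b by simp
    have "0 \<notin># \<nu> + replicate_mset (n - N) 1" using x by auto
    then have "\<nu> + replicate_mset (n - N) 1 \<in> partitions n"
      using x by (simp add: partitions_def)
    then show "(case x of (j, N, \<nu>) \<Rightarrow> \<nu> + replicate_mset (n - N) 1) \<in> ?P"
      unfolding x(1) prod.case mem_Collect_eq b(1) using b(2) by (rule conjI)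
    show "mfps_scale (pan_coeff n (case x of (j, N, \<nu>) \<Rightarrow> \<nu> + replicate_mset (n - N) 1))
        (star_sf_part (case x of (j, N, \<nu>) \<Rightarrow> \<nu> + replicate_mset (n - N) 1)) =
      (case x of (j, N, \<nu>) \<Rightarrow>
        mfps_scale (star_coeff n j N \<nu>) (star_sf_part (\<nu> + replicate_mset (n - N) 1)))"
      using x b by (simp add: pan_coeff_def)
  next
    fix \<mu> assume \<mu>: "\<mu> \<in> ?P"
    then have "n - \<Sum>\<^sub># (big_parts \<mu>) = count \<mu> 1"
      using partition_big_parts(1) [of \<mu> n] by simp
    then show "(case (size (big_parts \<mu>), \<Sum>\<^sub># (big_parts \<mu>), big_parts \<mu>) of
        (j, N, \<nu>) \<Rightarrow> \<nu> + replicate_mset (n - N) 1) = \<mu>"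
      using \<mu> big_parts_plus_ones [of \<mu>] by (simp add: partitions_def)
    have "1 \<le> size (big_parts \<mu>)"
      using \<mu> by (metis (mono_tags, lifting) One_nat_def Suc_leI mem_Collect_eq nonempty_has_size)
    moreover have "\<Sum>\<^sub># (big_parts \<mu>) \<le> n" "size (big_parts \<mu>) \<le> n"
      using \<mu> partition_big_parts [of \<mu> n] by auto
    moreover have "big_parts \<mu> \<in> big_partitions (size (big_parts \<mu>)) (\<Sum>\<^sub># (big_parts \<mu>))"
      by (simp add: big_partitions_def)
    ultimately show "(size (big_parts \<mu>), \<Sum>\<^sub># (big_parts \<mu>), big_parts \<mu>) \<in> ?I"
      by (simp only: mem_Sigma_iff atLeastAtMost_iff le0 simp_thms)
  qed
  also have "\<dots> = (\<Sum>\<mu> \<in> partitions n. mfps_scale (pan_coeff n \<mu>) (star_sf_part \<mu>))"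
    by (rule sum.mono_neutral_left) (auto simp: finite_partitions pan_coeff_def)
  finally show ?thesis .
qed

lemma multinomial_eq_card:
  assumes "\<mu> \<in> partitions n"
  shows "multinomial {2..n} (count \<mu>) = of_nat (card (permutations_of_multiset (big_parts \<mu>)))"
proof -
  let ?\<nu> = "big_parts \<mu>"
  have "k \<le> n" if "k \<in># ?\<nu>" for k
  proof -
    have "k \<le> \<Sum>\<^sub># \<mu>" using that by (auto dest!: multi_member_split)
    then show ?thesis using assms by (simp add: partitions_def)
  qed
  then have sub: "set_mset ?\<nu> \<subseteq> {2..n}" by auto
  have count: "count \<mu> i = count ?\<nu> i" if "i \<in> {2..n}" for i using that by simp
  have "(\<Sum>i \<in> {2..n}. count \<mu> i) = (\<Sum>i \<in> set_mset ?\<nu>. count ?\<nu> i)"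
    by (rule sum.mono_neutral_cong_right [OF _ sub]) (auto simp: count_eq_zero_iff)
  also have "\<dots> = size ?\<nu>" by (simp add: size_multiset_overloaded_eq)
  finally have 1: "(\<Sum>i \<in> {2..n}. count \<mu> i) = size ?\<nu>" .
  have 2: "(\<Prod>i \<in> {2..n}. fact (count \<mu> i)) = (\<Prod>i \<in> set_mset ?\<nu>. fact (count ?\<nu> i) :: rat)"
  proof (rule prod.mono_neutral_cong_right [OF _ sub])
    show "\<forall>i \<in> {2..n} - set_mset ?\<nu>. fact (count \<mu> i) = (1 :: rat)"
    proof
      fix i assume "i \<in> {2..n} - set_mset ?\<nu>"
      then have "i \<notin># \<mu>" by auto
      then show "fact (count \<mu> i) = (1 :: rat)" by (simp add: not_in_iff)
    qed
  qed auto
  have "of_nat (card (permutations_of_multiset ?\<nu>)) * (\<Prod>i \<in> set_mset ?\<nu>. fact (count ?\<nu> i)) =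
      (fact (size ?\<nu>) :: rat)"
    using arg_cong [OF card_permutations_of_multiset_aux [of ?\<nu>], of "of_nat :: nat \<Rightarrow> rat"] by simp
  then show ?thesis
    unfolding multinomial_def 1 2 by (simp add: divide_simps)
qed

text \<open>With \<open>j = 1\<close> and \<open>N = n - m\<close> the two terms of
  \<open>star_coeff\<close> combine to \<open>n - 2 - m\<close> times \<open>n - 2 choose m\<close>,
  and absorption moves the factor to \<open>n - 2\<close>.\<close>

lemma pan_coeff_hook:
  assumes "n \<ge> 4" "m \<le> n - 2"
  shows "pan_coeff n (add_mset (n - m) (replicate_mset m 1)) =
    (- 1) ^ m * of_nat (n - 2) * of_nat ((n - 3) choose m)"
proof -
  have "big_parts (add_mset (n - m) (replicate_mset m 1)) = {#n - m#}"
    using assms by (auto simp: filter_mset_eq_conv)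
  moreover have "n - (n - m) = m" "n - m - 1 + m - 1 = n - 2"
    using assms by auto
  ultimately have "pan_coeff n (add_mset (n - m) (replicate_mset m 1)) =
      (- 1) ^ m * ((of_nat (n - m) - 1) * of_nat (n - 2 choose m) - of_nat (n - 2 choose m))"
    by (simp add: pan_coeff_def star_coeff_def del: of_nat_diff)
  also have "(of_nat (n - m) - 1) * of_nat (n - 2 choose m) - of_nat (n - 2 choose m) =
      (of_nat ((n - 2 - m) * (n - 2 choose m)) :: rat)"
  proof -
    have "n - m = (n - 2 - m) + 2" using assms by simp
    then have "(of_nat (n - m) :: rat) = of_nat (n - 2 - m) + 2" by (metis of_nat_add of_nat_numeral)
    then show ?thesis by (simp only: of_nat_mult) (simp add: ring_distribs del: of_nat_diff)
  qed
  also have "(n - 2 - m) * (n - 2 choose m) = (n - 2) * (n - 3 choose m)"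
    using binomial_absorb_comp [of "n - 2" m] by (simp add: numeral_3_eq_3 numeral_2_eq_2)
  finally show ?thesis by simp
qed

text \<open>Hooks are exactly the partitions with at most one part above one, so here the
  \<open>j = 1\<close> correction is absent, and \<open>N - j\<close> equals
  \<open>n - size \<mu>\<close>.\<close>

lemma pan_coeff_non_hook:
  assumes "\<mu> \<in> partitions n" "\<not> is_hook n \<mu>" "n \<ge> 4"
  shows "pan_coeff n \<mu> = (- 1) ^ count \<mu> 1 *
    ((of_nat n - of_nat (size \<mu>)) / (of_nat (size \<mu>) - of_nat (count \<mu> 1))) *
    multinomial {2..n} (count \<mu>) * of_nat ((n - size \<mu> + count \<mu> 1 - 1) choose count \<mu> 1)"
proof -
  let ?\<nu> = "big_parts \<mu>"
  note \<nu> = partition_big_parts [OF assms(1)]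
  have \<mu>: "\<mu> = ?\<nu> + replicate_mset (count \<mu> 1) 1"
    using assms(1) by (intro big_parts_plus_ones) (simp add: partitions_def)
  have nonempty: "?\<nu> \<noteq> {#}"
  proof
    assume empty: "?\<nu> = {#}"
    then have "n = count \<mu> 1" using \<nu>(1) by (simp only: empty sum_mset.empty add_0)
    then have "\<mu> = replicate_mset (Suc (n - 1)) 1"
      using \<mu> empty assms(3) by (metis Suc_pred' add_0 le_zero_eq gr0I zero_neq_numeral)
    then have "\<mu> = add_mset 1 (replicate_mset (n - 1) 1)" by simp
    moreover have "1 \<in> {1..n}" using assms(3) by simp
    ultimately show False using assms(2) unfolding is_hook_def by blast
  qed
  have size: "size ?\<nu> \<noteq> 1"
  proof
    assume "size ?\<nu> = 1"
    then obtain a where a: "?\<nu> = {#a#}" by (metis One_nat_def size_1_singleton_mset)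
    then have "\<mu> = add_mset a (replicate_mset (n - a) 1)" "a \<in> {1..n}"
      using \<mu> \<nu> by auto
    then show False using assms(2) unfolding is_hook_def by blast
  qed
  have diff: "n - \<Sum>\<^sub># ?\<nu> = count \<mu> 1" "\<Sum>\<^sub># ?\<nu> - size ?\<nu> = n - size \<mu>"
    using \<nu> by linarith+
  have "of_nat (size ?\<nu>) + of_nat (count \<mu> 1) = (of_nat (size \<mu>) :: rat)"
    "of_nat (\<Sum>\<^sub># ?\<nu>) + of_nat (count \<mu> 1) = (of_nat n :: rat)"
    by (simp_all only: of_nat_add [symmetric] \<nu>)
  then have of_nat: "(of_nat (size ?\<nu>) :: rat) = of_nat (size \<mu>) - of_nat (count \<mu> 1)"
    "(of_nat (\<Sum>\<^sub># ?\<nu>) :: rat) - (of_nat (size \<mu>) - of_nat (count \<mu> 1)) = of_nat n - of_nat (size \<mu>)"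
    by linarith+
  have "pan_coeff n \<mu> = star_coeff n (size ?\<nu>) (\<Sum>\<^sub># ?\<nu>) ?\<nu>"
    using nonempty by (simp only: pan_coeff_def if_False)
  also have "\<dots> = of_nat (card (permutations_of_multiset ?\<nu>)) * (- 1) ^ count \<mu> 1 *
      ((of_nat n - of_nat (size \<mu>)) / (of_nat (size \<mu>) - of_nat (count \<mu> 1)) *
       of_nat ((n - size \<mu> + count \<mu> 1 - 1) choose count \<mu> 1))"
    using size by (simp only: star_coeff_def diff of_nat if_False diff_zero)
  finally show ?thesis
    by (simp only: multinomial_eq_card [OF assms(1)] ac_simps)
qed

theorem proposition4p8:
  fixes n :: nat and c :: "nat multiset \<Rightarrow> rat"
  assumes "n \<ge> 4"
    and "chromatic_sf (pan_graph n) = (\<Sum>\<mu> \<in> partitions n. mfps_scale (c \<mu>) (star_sf_part \<mu>))"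
  shows "(\<forall>m1 \<le> n - 2. c (add_mset (n - m1) (replicate_mset m1 1)) =
            (- 1) ^ m1 * of_nat (n - 2) * of_nat ((n - 3) choose m1)) \<and>
         (\<forall>\<mu> \<in> partitions n. \<not> is_hook n \<mu> \<longrightarrow>
            c \<mu> = (- 1) ^ count \<mu> 1 *
              ((of_nat n - of_nat (size \<mu>)) / (of_nat (size \<mu>) - of_nat (count \<mu> 1))) *
              multinomial {2..n} (count \<mu>) *
              of_nat ((n - size \<mu> + count \<mu> 1 - 1) choose count \<mu> 1)) \<and>
         c (replicate_mset n 1) = 0"
proof -
  have "(\<Sum>\<mu> \<in> partitions n. mfps_scale (c \<mu> - pan_coeff n \<mu>) (star_sf_part \<mu>)) = 0"
    using assms by (simp add: pan_sf_star_expansion mfps.scale_left_diff_distrib sum_subtractf)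
  then have c: "c \<mu> = pan_coeff n \<mu>" if "\<mu> \<in> partitions n" for \<mu>
    using star_sf_part_independent [where n = n and d = "\<lambda>\<mu>. c \<mu> - pan_coeff n \<mu>"] that by simp
  show ?thesis
  proof (intro conjI allI ballI impI)
    fix m1 assume m1: "m1 \<le> n - 2"
    then have "add_mset (n - m1) (replicate_mset m1 1) \<in> partitions n"
      using assms(1) by (auto simp: partitions_def)
    then show "c (add_mset (n - m1) (replicate_mset m1 1)) =
        (- 1) ^ m1 * of_nat (n - 2) * of_nat ((n - 3) choose m1)"
      using assms(1) m1 by (simp only: c pan_coeff_hook)
  next
    fix \<mu> assume \<mu>: "\<mu> \<in> partitions n" "\<not> is_hook n \<mu>"
    show "c \<mu> = (- 1) ^ count \<mu> 1 *
        ((of_nat n - of_nat (size \<mu>)) / (of_nat (size \<mu>) - of_nat (count \<mu> 1))) *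
        multinomial {2..n} (count \<mu>) *
        of_nat ((n - size \<mu> + count \<mu> 1 - 1) choose count \<mu> 1)"
      unfolding c [OF \<mu>(1)] using \<mu> assms(1) by (rule pan_coeff_non_hook)
  next
    have "replicate_mset n 1 \<in> partitions n"
      by (auto simp: partitions_def)
    then show "c (replicate_mset n 1) = 0"
      by (simp add: c pan_coeff_def)
  qed
qed

end
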